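(* Let $N\geq 2$ and let $\mathcal{A}$ be an $N$-colored Adinkra on $v$ vertices, with underlying (unsigned) graph $G$. Let $L(G)$ be the Laplacian of $G$, and define the integer $m$ by requiring that the rank of $L(G)$ over $\mathbb{F}_2$ equals $v/2-m$. Then $$\mathcal{K}(\mathcal{A})\cong(\mathbb{Z}/2\mathbb{Z})^m\oplus\left(\mathbb{Z}/\tfrac{N^2-N}{2}\mathbb{Z}\right)^m\oplus\left(\mathbb{Z}/(N^2-N)\mathbb{Z}\right)^{v/2-m}.$$
   Context: Graphs are finite, simple, connected. A signed graph is a graph $G$ with a map $\sigma:E(G)\to\{\pm\}$. For $N\geq 2$, an $N$-colored Adinkra is a signed graph whose edges are each colored by one of $N$ colors such that: (1) the graph is bipartite; (2) every vertex is incident to exactly one edge of each color; (3) for every pair of distinct colors, the subgraph formed by the edges of these two colors is a disjoint union of $4$-cycles; (4) each such bi-colored $4$-cycle contains an odd number of negative edges. The Laplacian of a signed graph $G_\sigma$ is $L(G_\sigma)=D-A_\sigma$, where $D$ is the diagonal matrix of vertex degrees and $A_\sigma$ is the signed adjacency matrix ($A_{xy}=A_{yx}=1$ for a positive edge $xy$, $-1$ for a negative edge, $0$ for non-edges); the Laplacian $L(G)$ of an unsigned graph is the case $\sigma\equiv +$. The critical group $\mathcal{K}(G_\sigma)$ is the torsion subgroup of the cokernel of $L(G_\sigma)$ viewed as a map $\mathbb{Z}^{V}\to\mathbb{Z}^{V}$ (for an Adinkra this cokernel is finite). *)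

theory Defs
  imports "HOL-Analysis.Analysis" "HOL-Library.Z2" "HOL-Algebra.Product_Groups"
begin

section \<open>Graphs and Adinkras\<close>

text \<open>
  A graph has as vertex set the (nonempty, finite) type \<open>'v\<close>; an edge is a two-element set of
  vertices. Signs and colours are functions on edges, whose values outside the edge set are
  irrelevant; the signs \<open>+\<close> and \<open>-\<close> are the integers \<open>1\<close> and \<open>-1\<close>.
\<close>

locale connected_simple_graph =
  fixes E :: "'v::finite set set"
  assumes card_edge: "e \<in> E \<Longrightarrow> card e = 2"
    and connected: "(x, y) \<in> {(a, b). {a, b} \<in> E}\<^sup>*"

locale signed_graph = connected_simple_graph E
  for E :: "'v::finite set set" +
  fixes \<sigma> :: "'v set \<Rightarrow> int"
  assumes sign_edge: "\<sigma> \<in> E \<rightarrow> {1, -1}"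

definition bipartite :: "'v set set \<Rightarrow> bool" where
  "bipartite E \<longleftrightarrow> (\<exists>S. \<forall>e\<in>E. \<exists>x\<in>S. \<exists>y\<in>-S. e = {x, y})"

definition four_cycle :: "'v set set \<Rightarrow> bool" where
  "four_cycle C \<longleftrightarrow>
     (\<exists>a b c d. distinct [a, b, c, d] \<and> C = {{a, b}, {b, c}, {c, d}, {d, a}})"

definition disjoint_union_of_four_cycles :: "'v set set \<Rightarrow> bool" where
  "disjoint_union_of_four_cycles F \<longleftrightarrow>
     (\<exists>\<C>. (\<forall>C\<in>\<C>. four_cycle C) \<and>
           pairwise (\<lambda>C D. \<Union>C \<inter> \<Union>D = {}) \<C> \<and> F = \<Union>\<C>)"

definition bicolored_edges :: "'v set set \<Rightarrow> ('v set \<Rightarrow> nat) \<Rightarrow> nat \<Rightarrow> nat \<Rightarrow> 'v set set" where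
  "bicolored_edges E col i j = {e \<in> E. col e = i \<or> col e = j}"

locale adinkra = signed_graph E \<sigma>
  for E :: "'v::finite set set" and \<sigma> :: "'v set \<Rightarrow> int" +
  fixes N :: nat and col :: "'v set \<Rightarrow> nat"
  assumes col_edge: "col \<in> E \<rightarrow> {..<N}"
    and is_bipartite: "bipartite E"
    and unique_edge: "i < N \<Longrightarrow> \<exists>!e. e \<in> E \<and> x \<in> e \<and> col e = i"
    and bicolored_cycles:
      "\<lbrakk>i < N; j < N; i \<noteq> j\<rbrakk> \<Longrightarrow> disjoint_union_of_four_cycles (bicolored_edges E col i j)"
    and odd_dashing:
      "\<lbrakk>i < N; j < N; i \<noteq> j; C \<subseteq> bicolored_edges E col i j; four_cycle C\<rbrakk>
        \<Longrightarrow> odd (card {e \<in> C. \<sigma> e = -1})"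

section \<open>Laplacians and critical groups\<close>

definition degree_matrix :: "'v::finite set set \<Rightarrow> int^'v^'v" where
  "degree_matrix E = (\<chi> x y. if x = y then int (card {e \<in> E. x \<in> e}) else 0)"

definition signed_adjacency :: "'v::finite set set \<Rightarrow> ('v set \<Rightarrow> int) \<Rightarrow> int^'v^'v" where
  "signed_adjacency E \<sigma> = (\<chi> x y. if {x, y} \<in> E then \<sigma> {x, y} else 0)"

definition signed_laplacian :: "'v::finite set set \<Rightarrow> ('v set \<Rightarrow> int) \<Rightarrow> int^'v^'v" where
  "signed_laplacian E \<sigma> = degree_matrix E - signed_adjacency E \<sigma>"

definition laplacian :: "'v::finite set set \<Rightarrow> int^'v^'v" where
  "laplacian E = signed_laplacian E (\<lambda>_. 1)"

definition rank_F2 :: "int^'n^'m \<Rightarrow> nat" where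
  "rank_F2 A = rank (map_matrix of_int A :: bit^'n^'m)"

definition int_vec_group :: "(int^'n) monoid" where
  "int_vec_group = \<lparr>carrier = UNIV, monoid.mult = (+), one = 0\<rparr>"

definition cokernel :: "int^'n^'m \<Rightarrow> (int^'m) set monoid" where
  "cokernel A = int_vec_group Mod range (\<lambda>x. A *v x)"

definition torsion_subgroup :: "('a, 'b) monoid_scheme \<Rightarrow> ('a, 'b) monoid_scheme" where
  "torsion_subgroup G =
     G\<lparr>carrier := {g \<in> carrier G. \<exists>n::nat. n > 0 \<and> g [^]\<^bsub>G\<^esub> n = \<one>\<^bsub>G\<^esub>}\<rparr>"

definition critical_group ::
    "'v::finite set set \<Rightarrow> ('v set \<Rightarrow> int) \<Rightarrow> (int^'v) set monoid" where
  "critical_group E \<sigma> = torsion_subgroup (cokernel (signed_laplacian E \<sigma>))"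

text \<open>\<open>(\<int>/n\<int>)\<^sup>k\<close>\<close>

definition cyclic_power :: "nat \<Rightarrow> nat \<Rightarrow> (nat \<Rightarrow> int) monoid" where
  "cyclic_power n k = product_group {..<k} (\<lambda>_. integer_mod_group n)"

end

theory Submission
  imports Defs "HOL-Algebra.Multiplicative_Group"
begin

text \<open>
  Let \<open>A\<close> be the signed adjacency matrix, a sum of pairwise anticommuting involutions \<open>A\<^sub>i\<close>, one
  for each colour. Hence \<open>A\<^sup>2 = N\<close> and \<open>A A\<^sub>0 + A\<^sub>0 A = 2\<close>, and the sign matrix \<open>S\<close> of the
  bipartition conjugates \<open>A\<close> to \<open>-A\<close>. So \<open>L = N - A\<close> is conjugate to \<open>L' = N + A\<close>, and
  \<open>L L' = M\<close> with \<open>M = N\<^sup>2 - N\<close>. The anticommutator also provides integral matrices with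
  \<open>L' X + Y L = 2\<close>. Let \<open>d\<^sub>1 | d\<^sub>2 | \<dots>\<close> be the invariant factors of \<open>L\<close>. If some \<open>d\<^sub>i\<close> in the first
  half did not divide \<open>2\<close>, this relation would force a zero block with more than half of the
  rows and columns into a unimodular matrix modulo a non-unit. So the first half of the invariant
  factors divide \<open>2\<close>; applied to \<open>L'\<close>, the second half are \<open>M/2\<close> or \<open>M\<close>. Comparing with
  \<open>(det L)\<^sup>2 = M\<^sup>v\<close>, there are as many factors \<open>2\<close> as factors \<open>M/2\<close>, and reduction modulo \<open>2\<close>
  identifies their number as \<open>m\<close>.
\<close>

section \<open>Smith normal form of integer matrices\<close>

text \<open>One step adds multiples of a single line \<open>a\<close> to all other lines of the
  block at once, so that one rule clears a whole row or column; \<open>c a = 0\<close> keeps the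
  line \<open>a\<close> itself fixed.\<close>

inductive shear_equiv :: "'n set \<Rightarrow> int^'n^'n \<Rightarrow> int^'n^'n \<Rightarrow> bool" for S A where
  refl: "shear_equiv S A A"
| row: "\<lbrakk>shear_equiv S A B; a \<in> S; c a = 0; \<And>i. i \<notin> S \<Longrightarrow> c i = 0\<rbrakk>
    \<Longrightarrow> shear_equiv S A (\<chi> i j. B$i$j + c i * B$a$j)"
| col: "\<lbrakk>shear_equiv S A B; a \<in> S; c a = 0; \<And>i. i \<notin> S \<Longrightarrow> c i = 0\<rbrakk>
    \<Longrightarrow> shear_equiv S A (\<chi> i j. B$i$j + c j * B$i$a)"

lemma invertible_mat_1: "invertible (mat 1 :: 'a::semiring_1^'n^'n)"
  unfolding invertible_def by (intro exI[of _ "mat 1"]) simp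

text \<open>Because the coefficient at \<open>a\<close> is zero, shears along \<open>a\<close>
  compose by adding coefficients, and \<open>- c\<close> gives the inverse.\<close>

lemma row_shear_invertible:
  fixes c :: "'n::finite \<Rightarrow> int"
  assumes "c a = 0"
  shows "invertible (\<chi> i j. of_bool (i = j) + c i * of_bool (j = a))"
proof -
  let ?P = "\<lambda>c::'n \<Rightarrow> int. (\<chi> i j. of_bool (i = j) + c i * of_bool (j = a)) :: int^'n^'n"
  have "?P c ** ?P d = mat 1" if "c a = 0" "d a = 0" "\<And>i. c i + d i = 0" for c d
  proof -
    have "(\<Sum>k\<in>UNIV. (of_bool (i = k) + c i * of_bool (k = a)) *
        (of_bool (k = j) + d k * of_bool (j = a))) = (of_bool (i = j) :: int)" for i j
    proof -
      have "(\<Sum>k\<in>UNIV. (of_bool (i = k) + c i * of_bool (k = a)) *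
          (of_bool (k = j) + d k * of_bool (j = a)))
        = (\<Sum>k\<in>UNIV. (if k = i then (of_bool (k = j) + d k * of_bool (j = a)) else 0)
            + (if k = a then c i * (of_bool (k = j) + d k * of_bool (j = a)) else 0))"
        by (intro sum.cong) (auto simp: algebra_simps)
      also have "\<dots> = of_bool (i = j) + d i * of_bool (j = a) + c i * (of_bool (a = j) + d a * of_bool (j = a))"
        by (simp add: sum.distrib)
      also have "\<dots> = of_bool (i = j)"
        using that(2) that(3)[of i] by (auto simp: algebra_simps)
      finally show ?thesis .
    qed
    then show ?thesis
      by (auto simp: matrix_matrix_mult_def mat_def vec_eq_iff)
  qed
  from this[of c "\<lambda>i. - c i"] this[of "\<lambda>i. - c i" c] show ?thesis
    using assms unfolding invertible_def by auto
qed

lemma row_shear_eq_mult: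
  fixes B :: "int^'n^'m"
  shows "(\<chi> i j. B$i$j + c i * B$a$j) = (\<chi> i j. of_bool (i = j) + c i * of_bool (j = a)) ** B"
proof -
  have "(\<Sum>k\<in>UNIV. (of_bool (i = k) + c i * of_bool (k = a)) * B$k$j)
    = (\<Sum>k\<in>UNIV. (if k = i then B$k$j else 0) + (if k = a then c i * B$k$j else 0))" for i j
    by (intro sum.cong) (auto simp: algebra_simps)
  then show ?thesis
    by (simp add: matrix_matrix_mult_def vec_eq_iff sum.distrib)
qed

lemma invertible_transpose:
  fixes A :: "'a::comm_semiring_1^'n^'n"
  assumes "invertible A"
  shows "invertible (transpose A)"
proof -
  obtain A' where *: "A ** A' = mat 1" "A' ** A = mat 1"
    using assms unfolding invertible_def by blast
  have "transpose A ** transpose A' = mat 1" "transpose A' ** transpose A = mat 1"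
    by (simp_all add: * flip: matrix_transpose_mul)
  then show ?thesis unfolding invertible_def by blast
qed

lemma shear_equiv_invertible:
  fixes A :: "int^'n::finite^'n"
  assumes "shear_equiv S A B"
  shows "\<exists>P Q. invertible P \<and> invertible Q \<and> B = P ** A ** Q"
  using assms
proof induction
  case refl
  then show ?case
    by (intro exI[of _ "mat 1"]) (simp add: invertible_mat_1)
next
  case (row B a c)
  let ?R = "(\<chi> i j. of_bool (i = j) + c i * of_bool (j = a)) :: int^'n^'n"
  obtain P Q where PQ: "invertible P" "invertible Q" "B = P ** A ** Q"
    using row by blast
  have "(\<chi> i j. B$i$j + c i * B$a$j) = (?R ** P) ** A ** Q"
    unfolding row_shear_eq_mult by (simp add: PQ matrix_mul_assoc)
  moreover have "invertible (?R ** P)"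
    using PQ row row_shear_invertible invertible_mult by blast
  ultimately show ?case using PQ by blast
next
  case (col B a c)
  let ?R = "(\<chi> i j. of_bool (i = j) + c i * of_bool (j = a)) :: int^'n^'n"
  obtain P Q where PQ: "invertible P" "invertible Q" "B = P ** A ** Q"
    using col by blast
  \<comment> \<open>A column shear is the row shear of the transpose, hence multiplication by an
    invertible matrix from the right.\<close>
  have "(\<chi> i j. B$i$j + c j * B$i$a) = transpose (\<chi> i j. transpose B$i$j + c i * transpose B$a$j)"
    by (simp add: transpose_def)
  also have "\<dots> = B ** transpose ?R"
    unfolding row_shear_eq_mult by (simp add: matrix_transpose_mul)
  finally have "(\<chi> i j. B$i$j + c j * B$i$a) = P ** A ** (Q ** transpose ?R)"
    by (simp add: PQ matrix_mul_assoc)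
  moreover have "invertible (Q ** transpose ?R)"
    using PQ col row_shear_invertible invertible_mult invertible_transpose by blast
  ultimately show ?case using PQ by blast
qed

section \<open>Pivoting and diagonalisation\<close>

text \<open>The invariant of the reduction: only the block on \<open>S\<close> is still to be
  diagonalised. It is vacuous for \<open>UNIV\<close> and means diagonal for
  \<open>{}\<close>.\<close>

definition diagonal_off :: "'n set \<Rightarrow> int^'n^'n \<Rightarrow> bool" where
  "diagonal_off S A \<longleftrightarrow> (\<forall>i j. i \<noteq> j \<and> (i \<notin> S \<or> j \<notin> S) \<longrightarrow> A$i$j = 0)"

text \<open>Every line that is added has its index in \<open>S\<close>, so its entries at positions
  outside \<open>S\<close> are zero and the finished part does not change.\<close>

lemma shear_equiv_diagonal_off:
  assumes "shear_equiv S A B" "diagonal_off S A"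
  shows "diagonal_off S B" and "i \<notin> S \<Longrightarrow> B$i$i = A$i$i"
proof -
  have "diagonal_off S B \<and> (\<forall>i. i \<notin> S \<longrightarrow> B$i$i = A$i$i)"
    using assms
  proof induction
    case (row B a c)
    then show ?case unfolding diagonal_off_def by simp metis
  next
    case (col B a c)
    then show ?case unfolding diagonal_off_def by simp metis
  qed simp
  then show "diagonal_off S B" and "i \<notin> S \<Longrightarrow> B$i$i = A$i$i" by auto
qed

lemma shear_equiv_dvd:
  assumes "shear_equiv S A B" "\<And>i j. i \<in> S \<Longrightarrow> j \<in> S \<Longrightarrow> q dvd A$i$j" "i \<in> S" "j \<in> S"
  shows "q dvd B$i$j"
  using assms(1,3,4)
  by (induction arbitrary: i j) (auto simp: assms(2))

text \<open>Among all nonzero entries of matrices reachable from \<open>A\<close>, one of least absolute value divides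
  every entry of its matrix. In particular it divides the diagonal entry of its row, so that a shear
  moves it to the diagonal and no swaps are needed.\<close>

lemma pivot_step:
  fixes A :: "int^'n::finite^'n"
  assumes A: "diagonal_off S A" and "S \<noteq> {}"
  obtains B a where "shear_equiv S A B" "a \<in> S" "diagonal_off (S - {a}) B"
    "\<And>i j. i \<in> S \<Longrightarrow> j \<in> S \<Longrightarrow> B$a$a dvd B$i$j"
proof (cases "\<exists>B a b. shear_equiv S A B \<and> a \<in> S \<and> b \<in> S \<and> B$a$b \<noteq> 0")
  case False
  obtain a where "a \<in> S" using \<open>S \<noteq> {}\<close> by blast
  have "A$i$j = 0" if "i \<in> S" "j \<in> S" for i j
    using False that refl by blast
  then show ?thesis
    using that[of A a] A \<open>a \<in> S\<close> unfolding diagonal_off_def by (auto intro: refl)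
next
  case True
  define size where "size = (\<lambda>(B :: int^'n^'n, a, b). nat \<bar>B$a$b\<bar>)"
  define X where "X = {(B, a, b). shear_equiv S A B \<and> a \<in> S \<and> b \<in> S \<and> B$a$b \<noteq> 0}"
  obtain t where t: "t \<in> X" "\<And>s. s \<in> X \<Longrightarrow> size t \<le> size s"
    using True exists_least_iff[of "\<lambda>k. \<exists>t\<in>X. size t = k"] unfolding X_def
    by (smt (verit, ccfv_threshold) case_prodI linorder_not_less mem_Collect_eq)
  obtain B a b where [simp]: "t = (B, a, b)" by (cases t)
  define g where "g = B$a$b"
  have B: "shear_equiv S A B" "a \<in> S" "b \<in> S" "g \<noteq> 0"
    using t(1) by (auto simp: X_def g_def)
  have small: "C$i$j = 0" if "shear_equiv S A C" "i \<in> S" "j \<in> S" "\<bar>C$i$j\<bar> < \<bar>g\<bar>" for C i j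
  proof (rule ccontr)
    assume "C$i$j \<noteq> 0"
    then show False
      using t(2)[of "(C, i, j)"] that by (simp add: X_def size_def g_def)
  qed
  \<comment> \<open>The shear leaves the remainder modulo an entry of the size of \<open>g\<close>,
    and minimality makes it zero. This is stated for every reachable \<open>C\<close>, since
    matrices built later keep an entry of that size.\<close>
  have pivot_col: "C$a'$b' dvd C$i$b'"
    if C: "shear_equiv S A C" "a' \<in> S" "b' \<in> S" "\<bar>C$a'$b'\<bar> = \<bar>g\<bar>" "i \<in> S" for C a' b' i
  proof (cases "i = a'")
    case False
    have "shear_equiv S A (\<chi> k j. C$k$j + (if k = i then - (C$i$b' div C$a'$b') else 0) * C$a'$j)"
      by (rule row) (use C False in auto)
    from small[OF this \<open>i \<in> S\<close> \<open>b' \<in> S\<close>] have "C$i$b' mod C$a'$b' = 0"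
      using C B(4) abs_mod_less[of "C$a'$b'" "C$i$b'"] by (auto simp: minus_div_mult_eq_mod)
    then show ?thesis by (simp add: dvd_eq_mod_eq_0)
  qed simp
  have pivot_row: "C$a'$b' dvd C$a'$j"
    if C: "shear_equiv S A C" "a' \<in> S" "b' \<in> S" "\<bar>C$a'$b'\<bar> = \<bar>g\<bar>" "j \<in> S" for C a' b' j
  proof (cases "j = b'")
    case False
    have "shear_equiv S A (\<chi> i k. C$i$k + (if k = j then - (C$a'$j div C$a'$b') else 0) * C$i$b')"
      by (rule col) (use C False in auto)
    from small[OF this \<open>a' \<in> S\<close> \<open>j \<in> S\<close>] have "C$a'$j mod C$a'$b' = 0"
      using C B(4) abs_mod_less[of "C$a'$b'" "C$a'$j"] by (auto simp: minus_div_mult_eq_mod)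
    then show ?thesis by (simp add: dvd_eq_mod_eq_0)
  qed simp
  have g_dvd: "g dvd B$i$j" if ij: "i \<in> S" "j \<in> S" for i j
  proof (cases "i = a")
    case True
    then show ?thesis using pivot_row[of B a b j] B ij g_def by simp
  next
    case False
    obtain c where c: "B$i$b = g * c"
      using pivot_col[of B a b i] B ij g_def by auto
    \<comment> \<open>The multiplier \<open>1 - c\<close> turns the entry \<open>g * c\<close> back
      into \<open>g\<close>, so that \<open>pivot_row\<close> also applies in row
      \<open>i\<close>.\<close>
    define C where "C = (\<chi> k l. B$k$l + (if k = i then 1 - c else 0) * B$a$l)"
    have "shear_equiv S A C"
      unfolding C_def by (rule row) (use B ij False in auto)
    moreover have "C$i$b = g"
      by (simp add: C_def c g_def[symmetric] algebra_simps)
    ultimately have "g dvd C$i$j"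
      using pivot_row[of C i b j] B ij by simp
    moreover have "g dvd B$a$j"
      using pivot_row[of B a b j] B ij g_def by simp
    moreover have "B$i$j = C$i$j - (1 - c) * B$a$j"
      by (simp add: C_def)
    ultimately show ?thesis by simp
  qed
  obtain C where C: "shear_equiv S A C" "C$a$a = g"
  proof (cases "a = b")
    case True
    then show ?thesis using that[of B] B g_def by simp
  next
    case False
    obtain c where c: "B$a$a = g * c" using g_dvd[of a a] B by auto
    define C where "C = (\<chi> k l. B$k$l + (if l = a then 1 - c else 0) * B$k$b)"
    have "shear_equiv S A C"
      unfolding C_def by (rule col) (use B False in auto)
    moreover have "C$a$a = g"
      by (simp add: C_def c g_def[symmetric] algebra_simps)
    ultimately show ?thesis using that by blast
  qed
  \<comment> \<open>Clear column \<open>a\<close>, then row \<open>a\<close>; the second shear has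
    coefficient zero at \<open>a\<close> and keeps the cleared column.\<close>
  define D where "D = (\<chi> i j. C$i$j + (if i \<in> S - {a} then - (C$i$a div g) else 0) * C$a$j)"
  have D: "shear_equiv S A D"
    unfolding D_def by (rule row) (use C B in auto)
  define F where "F = (\<chi> i j. D$i$j + (if j \<in> S - {a} then - (D$a$j div g) else 0) * D$i$a)"
  have F: "shear_equiv S A F"
    unfolding F_def by (rule col) (use D B in auto)
  have D_col: "D$i$a = 0" if "i \<in> S - {a}" for i
    using that pivot_col[OF C(1), of a a i] C B by (simp add: D_def)
  have D_aa: "D$a$a = g"
    by (simp add: D_def C)
  have F_aa: "F$a$a = g"
    by (simp add: F_def D_aa)
  have F_row: "F$a$j = 0" if "j \<in> S - {a}" for j
    using that pivot_row[OF D, of a a j] D_aa B by (simp add: F_def)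
  have F_col: "F$i$a = 0" if "i \<in> S - {a}" for i
    using that D_col by (simp add: F_def)
  have "diagonal_off (S - {a}) F"
    using shear_equiv_diagonal_off(1)[OF F A] F_row F_col unfolding diagonal_off_def by blast
  moreover have "F$a$a dvd F$i$j" if ij: "i \<in> S" "j \<in> S" for i j
  proof (cases "i = a")
    case True
    then show ?thesis using F_row[of j] ij F_aa by (cases "j = a") auto
  next
    case i: False
    show ?thesis
    proof (cases "j = a")
      case True
      then show ?thesis using F_col[of i] ij i by auto
    next
      case False
      \<comment> \<open>Adding row \<open>i\<close> to the cleared row \<open>a\<close> copies
        \<open>F$i$j\<close> into the row of the pivot \<open>g\<close>, where
        \<open>pivot_row\<close> applies.\<close>
      define K where "K = (\<chi> k l. F$k$l + (if k = a then 1 else 0) * F$i$l)"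
      have "shear_equiv S A K"
        unfolding K_def by (rule row) (use F B ij i in auto)
      moreover have "K$a$a = g"
        using F_col[of i] ij i by (simp add: K_def F_aa)
      ultimately have "g dvd K$a$j"
        using pivot_row[of K a a j] B ij by simp
      then show ?thesis
        using F_row[of j] ij False by (simp add: K_def F_aa)
    qed
  qed
  ultimately show ?thesis using that F B by blast
qed

text \<open>Induction on \<open>card S\<close>, splitting off one pivot at a time. The last conjunct
  passes common divisors of the block on to the diagonal; taken at the pivot, it makes the first
  entry divide all later ones.\<close>

lemma smith_normal_form_on:
  fixes A :: "int^'n::finite^'n"
  assumes "diagonal_off S A"
  shows "\<exists>P Q D f. invertible P \<and> invertible Q \<and> D = P ** A ** Q \<and>
    diagonal_off {} D \<and> (\<forall>i. i \<notin> S \<longrightarrow> D$i$i = A$i$i) \<and>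
    bij_betw f {..<card S} S \<and> (\<forall>i j. i \<le> j \<and> j < card S \<longrightarrow> D$f i$f i dvd D$f j$f j) \<and>
    (\<forall>q. (\<forall>i\<in>S. \<forall>j\<in>S. q dvd A$i$j) \<longrightarrow> (\<forall>i\<in>S. q dvd D$i$i))"
  using assms
proof (induction "card S" arbitrary: S A)
  case 0
  then have "S = {}" by simp
  then show ?case
    using 0 by - (rule exI[of _ "mat 1"], rule exI[of _ "mat 1"], rule exI[of _ A],
        auto simp: invertible_mat_1 bij_betw_def)
next
  case (Suc n)
  then have "S \<noteq> {}" by auto
  then obtain B a where B: "shear_equiv S A B" "a \<in> S" "diagonal_off (S - {a}) B"
    "\<And>i j. i \<in> S \<Longrightarrow> j \<in> S \<Longrightarrow> B$a$a dvd B$i$j"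
    using pivot_step[OF Suc.prems] by metis
  have card: "n = card (S - {a})" "card S = Suc n" using Suc B by auto
  obtain P Q where PQ: "invertible P" "invertible Q" "B = P ** A ** Q"
    using shear_equiv_invertible B by blast
  obtain P' Q' D f where IH: "invertible P'" "invertible Q'" "D = P' ** B ** Q'"
    "diagonal_off {} D" "\<And>i. i \<notin> S - {a} \<Longrightarrow> D$i$i = B$i$i" "bij_betw f {..<n} (S - {a})"
    "\<And>i j. i \<le> j \<Longrightarrow> j < n \<Longrightarrow> D$f i$f i dvd D$f j$f j"
    "\<And>q. (\<forall>i\<in>S - {a}. \<forall>j\<in>S - {a}. q dvd B$i$j) \<Longrightarrow> (\<forall>i\<in>S - {a}. q dvd D$i$i)"
    using Suc.hyps(1)[OF card(1) B(3)] unfolding card(1)[symmetric] by blast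
  define f' where "f' = case_nat a f"
  have inv: "invertible (P' ** P)" "invertible (Q ** Q')" "D = (P' ** P) ** A ** (Q ** Q')"
    using PQ IH by (simp_all add: invertible_mult matrix_mul_assoc)
  have bij: "bij_betw f' {..<Suc n} S"
  proof -
    have "f' ` {..<Suc n} = insert a (f ` {..<n})"
      unfolding lessThan_Suc_eq_insert_0 f'_def by (simp add: image_image)
    also have "\<dots> = S" using IH(6) B(2) by (auto simp: bij_betw_def)
    finally show ?thesis
      by (simp add: bij_betw_def eq_card_imp_inj_on card)
  qed
  have chain: "D$f' i$f' i dvd D$f' j$f' j" if "i \<le> j" "j < Suc n" for i j
  proof (cases i)
    case 0
    show ?thesis
    proof (cases j)
      case (Suc k)
      then have "f k \<in> S - {a}" using IH(6) that by (auto simp: bij_betw_def)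
      then show ?thesis
        using IH(8)[of "B$a$a"] B IH(5)[of a] 0 Suc by (auto simp: f'_def)
    qed (simp add: 0)
  next
    case (Suc k)
    then show ?thesis using that IH(7) by (cases j) (auto simp: f'_def)
  qed
  have divisor: "q dvd D$i$i" if q: "\<forall>i\<in>S. \<forall>j\<in>S. q dvd A$i$j" and i: "i \<in> S" for q i
  proof -
    have *: "q dvd B$i$j" if "i \<in> S" "j \<in> S" for i j
      using shear_equiv_dvd[OF B(1)] q that by blast
    then show ?thesis
      using i IH(5)[of a] IH(8)[of q] by (cases "i = a") auto
  qed
  have outside: "D$i$i = A$i$i" if "i \<notin> S" for i
    using that IH(5) shear_equiv_diagonal_off(2)[OF B(1) Suc.prems] by simp
  show ?case
    unfolding card(2)
    by (rule exI[of _ "P' ** P"], rule exI[of _ "Q ** Q'"], rule exI[of _ D], rule exI[of _ f'])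
      (simp add: inv(1,2) inv(3)[symmetric] IH(4) bij chain divisor outside)
qed

text \<open>\<open>f\<close> lists the indices in divisibility order, since the index type has no
  order of its own. Signs are not normalised, which is why absolute values of the entries occur
  later.\<close>

theorem smith_normal_form:
  fixes A :: "int^'n::finite^'n"
  obtains P Q D :: "int^'n^'n" and f where "invertible P" "invertible Q" "D = P ** A ** Q"
    "\<And>i j. i \<noteq> j \<Longrightarrow> D$i$j = 0"
    "bij_betw f {..<CARD('n)} UNIV"
    "\<And>i j. i \<le> j \<Longrightarrow> j < CARD('n) \<Longrightarrow> D$f i$f i dvd D$f j$f j"
proof -
  have "diagonal_off UNIV A" by (simp add: diagonal_off_def)
  from smith_normal_form_on[OF this] obtain P Q D :: "int^'n^'n" and f where *: "invertible P" "invertible Q"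
    "D = P ** A ** Q" "diagonal_off {} D" "bij_betw f {..<CARD('n)} UNIV"
    "\<forall>i j. i \<le> j \<and> j < CARD('n) \<longrightarrow> D$f i$f i dvd D$f j$f j"
    by blast
  show thesis
    by (rule that[OF *(1-3) _ *(5)]) (use *(4,6) in \<open>simp_all add: diagonal_off_def\<close>)
qed

section \<open>Divisors of diagonal entries, and rank modulo 2\<close>

lemma unit_det_of_invertible:
  fixes A :: "'a::comm_ring_1^'n^'n"
  assumes "invertible A"
  shows "det A dvd 1"
  using assms unfolding invertible_def by (metis det_I det_mul dvd_triv_left)

text \<open>Every permutation maps some element of a set with more than half of the indices into
  that set.\<close>

lemma dvd_det_of_dvd_block:
  fixes A :: "'a::comm_ring_1^'n::finite^'n"
  assumes "CARD('n) < 2 * card J" and dvd: "\<And>i j. i \<in> J \<Longrightarrow> j \<in> J \<Longrightarrow> q dvd A$i$j"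
  shows "q dvd det A"
  unfolding det_def
proof (intro dvd_sum dvd_mult)
  fix p :: "'n \<Rightarrow> 'n"
  assume "p \<in> {p. p permutes UNIV}"
  then have "card (p ` J) = card J"
    by (intro card_image) (auto intro: inj_on_subset[OF permutes_inj])
  moreover have "card (J \<union> p ` J) \<le> CARD('n)"
    by (simp add: card_mono)
  ultimately have "J \<inter> p ` J \<noteq> {}"
    using assms(1) card_Un_disjoint[of J "p ` J"] by fastforce
  then obtain i where "i \<in> J" "p i \<in> J" by auto
  then have "q dvd A$i$p i" using dvd by blast
  also have "\<dots> dvd (\<Prod>i\<in>UNIV. A$i$p i)"
    by (rule dvd_prodI) auto
  finally show "q dvd (\<Prod>i\<in>UNIV. A$i$p i)" .
qed

section \<open>Products with diagonal and scalar matrices\<close>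

lemma diagonal_mult_right:
  fixes D :: "'a::comm_semiring_1^'n::finite^'n" and A :: "'a^'n^'m"
  assumes "\<And>i j. i \<noteq> j \<Longrightarrow> D$i$j = 0"
  shows "(A ** D)$i$j = A$i$j * D$j$j"
proof -
  have "(A ** D)$i$j = (\<Sum>k\<in>UNIV. if k = j then A$i$j * D$j$j else 0)"
    unfolding matrix_matrix_mult_def vec_lambda_beta
    by (intro sum.cong) (auto simp: assms)
  then show ?thesis by simp
qed

lemma diagonal_mult_left:
  fixes D :: "'a::comm_semiring_1^'n::finite^'n" and A :: "'a^'m^'n"
  assumes "\<And>i j. i \<noteq> j \<Longrightarrow> D$i$j = 0"
  shows "(D ** A)$i$j = D$i$i * A$i$j"
proof -
  have "(D ** A)$i$j = (\<Sum>k\<in>UNIV. if k = i then D$i$i * A$i$j else 0)"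
    unfolding matrix_matrix_mult_def vec_lambda_beta
    by (intro sum.cong) (auto simp: assms)
  then show ?thesis by simp
qed

lemma diagonal_vector_mult:
  fixes D :: "'a::comm_semiring_1^'n::finite^'n"
  assumes "\<And>i j. i \<noteq> j \<Longrightarrow> D$i$j = 0"
  shows "(D *v x)$i = D$i$i * x$i"
proof -
  have "(D *v x)$i = (\<Sum>k\<in>UNIV. if k = i then D$i$i * x$i else 0)"
    unfolding matrix_vector_mult_def vec_lambda_beta
    by (intro sum.cong) (auto simp: assms)
  then show ?thesis by simp
qed

lemma matrix_add_rdistrib:
  fixes A B :: "'a::semiring_1^'n^'m" and C :: "'a^'k^'n"
  shows "(A + B) ** C = A ** C + B ** C"
  by (simp add: matrix_matrix_mult_def vec_eq_iff sum.distrib distrib_right)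

lemma mat_mult_component:
  fixes A :: "'a::comm_semiring_1^'m^'n::finite"
  shows "(mat c ** A)$i$j = c * A$i$j"
  by (subst diagonal_mult_left) (auto simp: mat_def)

lemma mat_mult_component_right:
  fixes A :: "'a::comm_semiring_1^'m::finite^'n"
  shows "(A ** mat c)$i$j = c * A$i$j"
  by (subst diagonal_mult_right) (auto simp: mat_def mult.commute)

lemma mat_commute:
  fixes A :: "'a::comm_semiring_1^'n::finite^'n"
  shows "mat c ** A = A ** mat c"
  by (simp add: vec_eq_iff mat_mult_component mat_mult_component_right)

text \<open>Conjugating the relation by \<open>W\<close> turns it into \<open>mat c = R ** D + T ** D ** Z\<close> with \<open>T\<close>
  invertible; then \<open>q\<close> divides \<open>c\<close> times a large square block of the inverse of \<open>T\<close>.\<close>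

lemma diagonal_common_divisor:
  fixes A D U W S X Y :: "int^'n::finite^'n"
  assumes A: "A = U ** D ** W" and inv: "invertible U" "invertible W" "invertible S"
    and diag: "\<And>i j. i \<noteq> j \<Longrightarrow> D$i$j = 0"
    and rel: "mat c = S ** A ** S ** X + Y ** A"
    and J: "CARD('n) < 2 * card J" "\<And>j. j \<in> J \<Longrightarrow> q dvd D$j$j"
    and "c \<noteq> 0"
  shows "q dvd c"
proof -
  obtain W' where W': "W ** W' = mat 1" "W' ** W = mat 1"
    using inv(2) unfolding invertible_def by blast
  define T where "T = W ** S ** U"
  have "invertible T" unfolding T_def by (simp add: inv invertible_mult)
  then obtain T' where T': "T ** T' = mat 1" "T' ** T = mat 1"
    unfolding invertible_def by blast
  define Z where "Z = W ** S ** X ** W'"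
  define R where "R = W ** Y ** U"
  have "mat c = mat c ** (W ** W')" by (simp add: W')
  also have "\<dots> = W ** mat c ** W'" by (simp add: matrix_mul_assoc mat_commute)
  also have "\<dots> = T ** D ** Z + R ** D ** (W ** W')"
    unfolding rel A T_def Z_def R_def
    by (simp add: matrix_add_ldistrib matrix_add_rdistrib matrix_mul_assoc)
  finally have "mat c = T ** D ** Z + R ** D" by (simp add: W')
  then have "T' ** mat c = T' ** (T ** D ** Z) + T' ** (R ** D)"
    by (simp add: matrix_add_ldistrib)
  \<comment> \<open>With \<open>D\<close> leftmost in one term and rightmost in the other, a row and
    a column index in \<open>J\<close> make both terms multiples of \<open>q\<close>.\<close>
  then have eq: "T' ** mat c = D ** Z + (T' ** R) ** D"
    using T' by (simp add: matrix_mul_assoc)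
  have block: "q dvd c * T'$i$j" if "i \<in> J" "j \<in> J" for i j
  proof -
    have "c * T'$i$j = D$i$i * Z$i$j + (T' ** R)$i$j * D$j$j"
      using arg_cong[OF eq, of "\<lambda>M. M$i$j"]
      by (simp add: mat_mult_component_right diagonal_mult_left[OF diag] diagonal_mult_right[OF diag])
    then show ?thesis using J(2) that by simp
  qed
  \<comment> \<open>\<open>q'\<close> is coprime to what is left of \<open>c\<close> after removing
    the gcd, so it divides the block itself and hence the unit \<open>det T'\<close>; that
    \<open>q'\<close> is a unit means that \<open>q\<close> divides \<open>c\<close>.\<close>
  define q' where "q' = q div gcd q c"
  have "q' dvd T'$i$j" if "i \<in> J" "j \<in> J" for i j
  proof -
    have "coprime q' (c div gcd q c)"
      unfolding q'_def using \<open>c \<noteq> 0\<close> by (intro div_gcd_coprime) auto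
    moreover have "q' dvd (c div gcd q c) * T'$i$j"
    proof -
      have "gcd q c * q' dvd gcd q c * ((c div gcd q c) * T'$i$j)"
        using block[OF that] unfolding q'_def by (simp add: mult.assoc[symmetric])
      then show ?thesis using \<open>c \<noteq> 0\<close> by simp
    qed
    ultimately show ?thesis by (simp add: coprime_dvd_mult_right_iff)
  qed
  then have "q' dvd det T'"
    by (rule dvd_det_of_dvd_block[OF J(1)])
  also have "\<dots> dvd 1"
    using T' by (intro unit_det_of_invertible) (auto simp: invertible_def)
  finally have "is_unit q'" .
  moreover have "q = gcd q c * q'" unfolding q'_def by simp
  ultimately show ?thesis by (metis gcd_dvd2 mult_unit_dvd_iff)
qed

section \<open>Rank under invertible factors, and modulo 2\<close>

text \<open>\<open>rank\<close> is the dimension of the row span; seeing this span as an image lets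
  linear maps act on it.\<close>

lemma span_rows_eq_range:
  fixes A :: "'a::field^'n^'m"
  shows "vec.span (rows A) = range (\<lambda>x. transpose A *v x)"
proof (rule antisym)
  have "rows A \<subseteq> range (\<lambda>x. transpose A *v x)"
  proof
    fix r assume "r \<in> rows A"
    then obtain i where "r = row i A" unfolding rows_def by blast
    then have "r = transpose A *v axis i 1"
      by (simp add: vec_eq_iff row_def transpose_def matrix_vector_mult_def axis_def
          if_distrib cong: if_cong)
    then show "r \<in> range (\<lambda>x. transpose A *v x)" by blast
  qed
  moreover have "vec.subspace (range (\<lambda>x. transpose A *v x))"
    using vec.subspace_UNIV by (rule vec.subspace_image)
  ultimately show "vec.span (rows A) \<subseteq> range (\<lambda>x. transpose A *v x)"
    by (rule vec.span_minimal)
  show "range (\<lambda>x. transpose A *v x) \<subseteq> vec.span (rows A)"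
    using matrix_vector_mult_in_columnspace_gen[of "transpose A"] by (auto simp: columns_transpose)
qed

lemma rank_eq_dim_range_transpose:
  fixes A :: "'a::field^'n^'m"
  shows "rank A = vec.dim (range (\<lambda>x. transpose A *v x))"
  unfolding row_rank_def_gen by (metis span_rows_eq_range vec.dim_span)

text \<open>\<open>transpose P\<close> is onto and so does not change the image of
  \<open>transpose A\<close>, whose dimension the injective \<open>transpose Q\<close>
  preserves.\<close>

lemma rank_mult_invertible:
  fixes A P Q :: "'a::field^'n::finite^'n"
  assumes "invertible P" "invertible Q"
  shows "rank (P ** A ** Q) = rank A"
proof -
  obtain P' Q' where "P ** P' = mat 1" "Q ** Q' = mat 1"
    using assms unfolding invertible_def by blast
  then have *: "transpose P' ** transpose P = mat 1" "transpose Q' ** transpose Q = mat 1"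
    by (simp_all flip: matrix_transpose_mul)
  then have "surj ((*v) (transpose P))"
    using matrix_right_invertible_surjective matrix_left_right_inverse by blast
  have inj: "inj ((*v) (transpose Q))"
    using * matrix_left_invertible_injective by blast
  have "range (\<lambda>x. transpose (P ** A ** Q) *v x)
      = (*v) (transpose Q) ` (*v) (transpose A) ` range ((*v) (transpose P))"
    by (simp only: matrix_transpose_mul image_image matrix_vector_mul_assoc matrix_mul_assoc)
  also have "\<dots> = (*v) (transpose Q) ` range ((*v) (transpose A))"
    using \<open>surj ((*v) (transpose P))\<close> by simp
  finally show ?thesis
    unfolding rank_eq_dim_range_transpose
    using vec.dim_image_eq[OF matrix_vector_mul_linear_gen, of "transpose Q" "range ((*v) (transpose A))"] inj
    by (metis inj_on_subset subset_UNIV)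
qed

lemma rank_diagonal:
  fixes D :: "'a::field^'n::finite^'n"
  assumes diag: "\<And>i j. i \<noteq> j \<Longrightarrow> D$i$j = 0"
  shows "rank D = card {i. D$i$i \<noteq> 0}"
proof -
  let ?B = "(\<lambda>i. axis i (1::'a)) ` {i. D$i$i \<noteq> 0}"
  have row: "row i D = D$i$i *s axis i 1" for i
    using diag by (auto simp: row_def axis_def vec_eq_iff)
  have "vec.span (rows D) = vec.span ?B"
  proof (rule antisym)
    have "row i D \<in> vec.span ?B" for i
      unfolding row by (cases "D$i$i = 0") (auto intro: vec.span_scale vec.span_base vec.span_zero)
    then show "vec.span (rows D) \<subseteq> vec.span ?B"
      unfolding rows_def by (intro vec.span_minimal) auto
    have "axis i 1 \<in> vec.span (rows D)" if "D$i$i \<noteq> 0" for i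
    proof -
      have "axis i 1 = inverse (D$i$i) *s row i D"
        using that by (simp add: row vec_eq_iff)
      then show ?thesis
        unfolding rows_def by (metis (mono_tags) UNIV_I mem_Collect_eq vec.span_base vec.span_scale)
    qed
    then show "vec.span ?B \<subseteq> vec.span (rows D)"
      by (intro vec.span_minimal) auto
  qed
  moreover have "vec.independent ?B"
    by (rule vec.independent_mono[OF independent_cart_basis]) (auto simp: cart_basis_def)
  ultimately have "rank D = card ?B"
    unfolding row_rank_def_gen by (metis vec.dim_span vec.dim_eq_card_independent)
  also have "\<dots> = card {i. D$i$i \<noteq> 0}"
    by (rule card_image) (auto simp: inj_on_def axis_eq_axis)
  finally show ?thesis .
qed

lemma map_matrix_mult:
  fixes A :: "int^'n^'m" and B :: "int^'k^'n"
  shows "map_matrix of_int (A ** B) = (map_matrix of_int A ** map_matrix of_int B :: 'a::ring_1^'k^'m)"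
  by (simp add: vec_eq_iff matrix_matrix_mult_def)

lemma invertible_map_matrix:
  fixes A :: "int^'n^'n"
  assumes "invertible A"
  shows "invertible (map_matrix of_int A :: 'a::ring_1^'n^'n)"
proof -
  obtain B where "A ** B = mat 1" "B ** A = mat 1"
    using assms unfolding invertible_def by blast
  moreover have "map_matrix of_int (mat 1) = (mat 1 :: 'a^'n^'n)"
    by (simp add: vec_eq_iff mat_def)
  ultimately show ?thesis
    unfolding invertible_def by (metis map_matrix_mult)
qed

lemma of_int_bit_eq_0_iff: "(of_int k :: bit) = 0 \<longleftrightarrow> even k"
proof
  show "even k" if "(of_int k :: bit) = 0"
  proof (rule ccontr)
    assume "odd k"
    then obtain l where "k = 2 * l + 1" by (rule oddE)
    with that show False by simp
  qed
  show "(of_int k :: bit) = 0" if "even k"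
    using that by (auto elim!: evenE)
qed

text \<open>Matrices invertible over the integers stay invertible modulo 2, where exactly the odd
  diagonal entries survive.\<close>

lemma rank_F2_diagonal:
  fixes A P Q D :: "int^'n::finite^'n"
  assumes "invertible P" "invertible Q" "D = P ** A ** Q" "\<And>i j. i \<noteq> j \<Longrightarrow> D$i$j = 0"
  shows "rank_F2 A = card {i. odd (D$i$i)}"
proof -
  have "rank_F2 A = rank (map_matrix of_int D :: bit^'n^'n)"
    unfolding rank_F2_def assms(3) map_matrix_mult
    by (simp add: rank_mult_invertible invertible_map_matrix assms)
  also have "\<dots> = card {i. odd (D$i$i)}"
    by (subst rank_diagonal) (auto simp: assms(4) of_int_bit_eq_0_iff simp del: bit_not_zero_iff)
  finally show ?thesis .
qed

section \<open>Cokernels of diagonalised matrices\<close>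

lemma group_int_vec_group: "group int_vec_group"
proof (rule groupI)
  show "\<exists>y\<in>carrier int_vec_group. y \<otimes>\<^bsub>int_vec_group\<^esub> x = \<one>\<^bsub>int_vec_group\<^esub>" for x :: "int^'n"
    by (auto simp: int_vec_group_def intro: exI[of _ "- x"])
qed (auto simp: int_vec_group_def add.assoc)

lemma group_cyclic_power: "group (cyclic_power n k)"
  unfolding cyclic_power_def by simp

lemma finite_carrier_cyclic_power: "n > 0 \<Longrightarrow> finite (carrier (cyclic_power n k))"
  unfolding cyclic_power_def by (auto simp: carrier_integer_mod_group intro: finite_PiE)

lemma torsion_subgroup_finite:
  fixes G :: "('a, 'b) monoid_scheme"
  assumes "group G" "finite (carrier G)"
  shows "torsion_subgroup G = G"
proof -
  interpret group G by fact
  have "order G > 0" using assms(2) by (simp add: order_gt_0_iff_finite)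
  then have "{g \<in> carrier G. \<exists>n::nat. n > 0 \<and> g [^]\<^bsub>G\<^esub> n = \<one>\<^bsub>G\<^esub>} = carrier G"
    using pow_order_eq_1 by blast
  then show ?thesis unfolding torsion_subgroup_def by simp
qed

text \<open>\<open>P\<close> changes coordinates in the target and \<open>Q\<close> reparametrises
  the source, so the image becomes that of the diagonal matrix \<open>D\<close>.\<close>

lemma range_iff_diagonal_dvd:
  fixes A P Q D :: "int^'n::finite^'n"
  assumes "invertible P" "invertible Q" "D = P ** A ** Q" "\<And>i j. i \<noteq> j \<Longrightarrow> D$i$j = 0"
  shows "y \<in> range (\<lambda>x. A *v x) \<longleftrightarrow> (\<forall>i. D$i$i dvd (P *v y)$i)"
proof
  obtain P' Q' where PQ: "P' ** P = mat 1" "Q ** Q' = mat 1"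
    using assms unfolding invertible_def by blast
  assume "y \<in> range (\<lambda>x. A *v x)"
  then obtain x where "y = A *v x" by blast
  then have "P *v y = (P ** A ** (Q ** Q')) *v x"
    by (simp add: PQ matrix_vector_mul_assoc)
  also have "\<dots> = D *v (Q' *v x)"
    by (simp add: assms(3) matrix_vector_mul_assoc matrix_mul_assoc)
  finally show "\<forall>i. D$i$i dvd (P *v y)$i"
    by (simp add: diagonal_vector_mult[OF assms(4)])
next
  obtain P' Q' where PQ: "P' ** P = mat 1" "Q ** Q' = mat 1"
    using assms unfolding invertible_def by blast
  assume "\<forall>i. D$i$i dvd (P *v y)$i"
  then obtain z where z: "(P *v y)$i = D$i$i * z i" for i
    unfolding dvd_def by metis
  have "P *v y = D *v (\<chi> i. z i)"
    by (simp add: vec_eq_iff z diagonal_vector_mult[OF assms(4)])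
  then have "(P' ** P) *v y = (P' ** P ** A ** Q) *v (\<chi> i. z i)"
    by (metis assms(3) matrix_mul_assoc matrix_vector_mul_assoc)
  then have "y = A *v (Q *v (\<chi> i. z i))"
    by (simp add: PQ matrix_vector_mul_assoc)
  then show "y \<in> range (\<lambda>x. A *v x)" by blast
qed

lemma residues_hom:
  fixes P :: "int^'n::finite^'n"
  assumes "n > 0"
  shows "(\<lambda>y. \<lambda>k\<in>{..<l}. (P *v y)$g k mod int n) \<in> hom int_vec_group (cyclic_power n l)"
  using assms by (auto simp: hom_def int_vec_group_def cyclic_power_def carrier_integer_mod_group
      matrix_vector_right_distrib mod_add_eq intro!: restrict_ext)

text \<open>The first isomorphism theorem, for the map that reduces the coordinates of
  \<open>P *v y\<close> modulo \<open>a\<close> on \<open>X\<close>, \<open>b\<close> on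
  \<open>Y\<close> and \<open>c\<close> on \<open>Z\<close>; the other diagonal entries are units.
  The classes are index sets because moduli may coincide: for \<open>N = 2\<close> they will be 2, 1
  and 2.\<close>

lemma cokernel_iso_cyclic_powers:
  fixes A P Q D :: "int^'n::finite^'n"
  assumes PQ: "invertible P" "invertible Q" "D = P ** A ** Q" "\<And>i j. i \<noteq> j \<Longrightarrow> D$i$j = 0"
    and disj: "X \<inter> Y = {}" "X \<inter> Z = {}" "Y \<inter> Z = {}"
    and pos: "a > 0" "b > 0" "c > 0"
    and D: "\<And>i. i \<in> X \<Longrightarrow> \<bar>D$i$i\<bar> = int a" "\<And>i. i \<in> Y \<Longrightarrow> \<bar>D$i$i\<bar> = int b"
      "\<And>i. i \<in> Z \<Longrightarrow> \<bar>D$i$i\<bar> = int c" "\<And>i. i \<notin> X \<union> Y \<union> Z \<Longrightarrow> \<bar>D$i$i\<bar> = 1"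
  shows "group (cokernel A)"
    and "cokernel A \<cong> cyclic_power a (card X) \<times>\<times> cyclic_power b (card Y) \<times>\<times> cyclic_power c (card Z)"
      (is "_ \<cong> ?H")
proof -
  obtain f where f: "bij_betw f {..<card X} X"
    by (metis atLeast0LessThan ex_bij_betw_nat_finite finite)
  obtain g where g: "bij_betw g {..<card Y} Y"
    by (metis atLeast0LessThan ex_bij_betw_nat_finite finite)
  obtain h where h: "bij_betw h {..<card Z} Z"
    by (metis atLeast0LessThan ex_bij_betw_nat_finite finite)
  define \<rho> where "\<rho> n l f = (\<lambda>y. \<lambda>k\<in>{..<l}. (P *v y)$f k mod int n)" for n l and f :: "nat \<Rightarrow> 'n"
  define \<phi> where "\<phi> = (\<lambda>y. (\<rho> a (card X) f y, \<rho> b (card Y) g y, \<rho> c (card Z) h y))"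
  have "\<phi> \<in> hom int_vec_group ?H"
    unfolding hom_pairwise using residues_hom pos by (auto simp: \<phi>_def \<rho>_def o_def)
  then interpret group_hom int_vec_group ?H \<phi>
    by (intro group_hom.intro group_hom_axioms.intro DirProd_group group_cyclic_power group_int_vec_group)
  have zero_iff: "(\<rho> n l f y = \<one>\<^bsub>cyclic_power n l\<^esub>) \<longleftrightarrow> (\<forall>i\<in>S. D$i$i dvd (P *v y)$i)"
    if "bij_betw f {..<l} S" "\<And>i. i \<in> S \<Longrightarrow> \<bar>D$i$i\<bar> = int n" for n l f S y
  proof -
    have "(\<rho> n l f y = \<one>\<^bsub>cyclic_power n l\<^esub>) \<longleftrightarrow> (\<forall>k<l. int n dvd (P *v y)$f k)"
      by (auto simp: \<rho>_def cyclic_power_def fun_eq_iff dvd_eq_mod_eq_0)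
    also have "\<dots> \<longleftrightarrow> (\<forall>i\<in>S. int n dvd (P *v y)$i)"
      using that(1) by (auto simp: bij_betw_def)
    also have "\<dots> \<longleftrightarrow> (\<forall>i\<in>S. D$i$i dvd (P *v y)$i)"
      using that(2) by (metis abs_dvd_iff)
    finally show ?thesis .
  qed
  have "y \<in> kernel int_vec_group ?H \<phi> \<longleftrightarrow> y \<in> range (\<lambda>x. A *v x)" for y
  proof -
    have "y \<in> kernel int_vec_group ?H \<phi> \<longleftrightarrow> (\<forall>i\<in>X \<union> Y \<union> Z. D$i$i dvd (P *v y)$i)"
      using zero_iff[OF f D(1)] zero_iff[OF g D(2)] zero_iff[OF h D(3)]
      by (auto simp: kernel_def \<phi>_def int_vec_group_def)
    also have "\<dots> \<longleftrightarrow> (\<forall>i. D$i$i dvd (P *v y)$i)"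
      using D(4) by (metis abs_dvd_iff one_dvd)
    also have "\<dots> \<longleftrightarrow> y \<in> range (\<lambda>x. A *v x)"
      by (rule range_iff_diagonal_dvd[OF PQ, symmetric])
    finally show ?thesis .
  qed
  then have kernel: "cokernel A = int_vec_group Mod kernel int_vec_group ?H \<phi>"
    unfolding cokernel_def by (metis subsetI subset_antisym)
  then show "group (cokernel A)"
    using normal_kernel normal.factorgroup_is_group by metis
  have "\<phi> ` carrier int_vec_group = carrier ?H"
  proof
    show "\<phi> ` carrier int_vec_group \<subseteq> carrier ?H" by (intro image_subsetI hom_closed)
    show "carrier ?H \<subseteq> \<phi> ` carrier int_vec_group"
    proof
      fix t assume t: "t \<in> carrier ?H"
      obtain t1 t2 t3 where [simp]: "t = (t1, t2, t3)" by (cases t)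
      have t': "t1 \<in> carrier (cyclic_power a (card X))" "t2 \<in> carrier (cyclic_power b (card Y))"
        "t3 \<in> carrier (cyclic_power c (card Z))" using t by auto
      obtain P' where P': "P ** P' = mat 1" using PQ(1) unfolding invertible_def by blast
      \<comment> \<open>A preimage of \<open>t\<close>: put its components at their indices and undo
        \<open>P\<close>. The values outside the three classes are arbitrary.\<close>
      define z where "z = (\<chi> i. if i \<in> X then t1 (inv_into {..<card X} f i)
        else if i \<in> Y then t2 (inv_into {..<card Y} g i) else t3 (inv_into {..<card Z} h i))"
      have z: "P *v (P' *v z) = z" by (simp add: P' matrix_vector_mul_assoc)
      have *: "\<rho> n l f (P' *v z) = u"
        if "u \<in> carrier (cyclic_power n l)" "n > 0" "\<And>k. k < l \<Longrightarrow> z$f k = u k" for n l f u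
      proof
        show "\<rho> n l f (P' *v z) k = u k" for k
        proof (cases "k < l")
          case True
          then have "u k \<in> {0..<int n}"
            using that by (auto simp: cyclic_power_def carrier_integer_mod_group PiE_def)
          then show ?thesis using that True by (simp add: \<rho>_def z)
        next
          case False
          then show ?thesis using that
            by (auto simp: \<rho>_def cyclic_power_def PiE_def extensional_def)
        qed
      qed
      have "z$f k = t1 k" if "k < card X" for k
        using that f by (auto simp: z_def bij_betw_def)
      moreover have "z$g k = t2 k" if "k < card Y" for k
      proof -
        have "g k \<in> Y" using that g by (auto simp: bij_betw_def)
        then show ?thesis using that g disj by (auto simp: z_def bij_betw_def)
      qed
      moreover have "z$h k = t3 k" if "k < card Z" for k
      proof -
        have "h k \<in> Z" using that h by (auto simp: bij_betw_def)
        then show ?thesis using that h disj by (auto simp: z_def bij_betw_def)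
      qed
      ultimately have "\<phi> (P' *v z) = t"
        using *[OF t'(1) pos(1)] *[OF t'(2) pos(2)] *[OF t'(3) pos(3)] by (simp add: \<phi>_def)
      moreover have "P' *v z \<in> carrier int_vec_group" by (simp add: int_vec_group_def)
      ultimately show "t \<in> \<phi> ` carrier int_vec_group" by blast
    qed
  qed
  then show "cokernel A \<cong> ?H"
    unfolding kernel by (rule FactGroup_iso)
qed

text \<open>Positive moduli make the product finite, so the cokernel is finite and all of it is
  torsion.\<close>

lemma torsion_cokernel_iso_cyclic_powers:
  fixes A P Q D :: "int^'n::finite^'n"
  assumes PQ: "invertible P" "invertible Q" "D = P ** A ** Q" "\<And>i j. i \<noteq> j \<Longrightarrow> D$i$j = 0"
    and disj: "X \<inter> Y = {}" "X \<inter> Z = {}" "Y \<inter> Z = {}"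
    and pos: "a > 0" "b > 0" "c > 0"
    and D: "\<And>i. i \<in> X \<Longrightarrow> \<bar>D$i$i\<bar> = int a" "\<And>i. i \<in> Y \<Longrightarrow> \<bar>D$i$i\<bar> = int b"
      "\<And>i. i \<in> Z \<Longrightarrow> \<bar>D$i$i\<bar> = int c" "\<And>i. i \<notin> X \<union> Y \<union> Z \<Longrightarrow> \<bar>D$i$i\<bar> = 1"
  shows "torsion_subgroup (cokernel A)
    \<cong> cyclic_power a (card X) \<times>\<times> cyclic_power b (card Y) \<times>\<times> cyclic_power c (card Z)"
proof -
  note iso = cokernel_iso_cyclic_powers[OF assms]
  then obtain \<phi> where "bij_betw \<phi> (carrier (cokernel A))
      (carrier (cyclic_power a (card X) \<times>\<times> cyclic_power b (card Y) \<times>\<times> cyclic_power c (card Z)))"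
    unfolding is_iso_def iso_def by blast
  then have "finite (carrier (cokernel A))"
    using pos by (simp add: bij_betw_finite finite_carrier_cyclic_power)
  then show ?thesis using torsion_subgroup_finite iso by metis
qed

section \<open>Laplacians of square roots of scalar matrices\<close>

lemma matrix_minus_ldistrib:
  fixes A :: "'a::ring_1^'n^'m" and B C :: "'a^'k^'n"
  shows "A ** (B - C) = A ** B - A ** C"
  by (simp add: matrix_matrix_mult_def vec_eq_iff sum_subtractf right_diff_distrib)

lemma matrix_minus_rdistrib:
  fixes A B :: "'a::ring_1^'n^'m" and C :: "'a^'k^'n"
  shows "(A - B) ** C = A ** C - B ** C"
  by (simp add: matrix_matrix_mult_def vec_eq_iff sum_subtractf left_diff_distrib)

lemma mat_mult_left_commute:
  fixes A :: "'a::comm_semiring_1^'n::finite^'n"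
  shows "A ** (mat c ** B) = mat c ** (A ** B)"
  by (simp add: matrix_mul_assoc mat_commute)

lemma det_mat: "det (mat c :: 'a::comm_ring_1^'n::finite^'n) = c ^ CARD('n)"
  by (subst det_diagonal) (auto simp: mat_def)

lemma dvd_2_iff: "x dvd 2 \<longleftrightarrow> \<bar>x\<bar> = 1 \<or> \<bar>x\<bar> = 2" for x :: int
proof
  assume "x dvd 2"
  then have "x \<noteq> 0" "\<bar>x\<bar> \<le> 2" using zdvd_imp_le[of "\<bar>x\<bar>" 2] by auto
  then show "\<bar>x\<bar> = 1 \<or> \<bar>x\<bar> = 2" by linarith
qed (metis abs_dvd_iff one_dvd dvd_refl)

text \<open>\<open>A\<close> stands for the signed adjacency matrix, \<open>B\<close> for the matrix
  of a single colour and \<open>S\<close> for the sign matrix of the bipartition; the critical group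
  is computed from these relations and the evenness of the dimension.\<close>

locale anticommuting_matrices =
  fixes A B S :: "int^'n::finite^'n" and N :: nat
  assumes N: "N \<ge> 2"
    and A_square: "A ** A = mat (int N)"
    and anticommutator: "A ** B + B ** A = mat 2"
    and S_square: "S ** S = mat 1"
    and S_conj: "S ** A ** S = - A"
begin

definition L :: "int^'n^'n" where "L = mat (int N) - A"
definition L' :: "int^'n^'n" where "L' = mat (int N) + A"
definition M :: int where "M = int N * (int N - 1)"

lemma M_pos: "M > 0"
  using N by (simp add: M_def)

lemma even_M: "even M"
  by (simp add: M_def)

lemma M_eq: "M = int (N^2 - N)"
proof -
  have "N \<le> N^2" using N by (simp add: power2_eq_square)
  then have "int (N^2 - N) = int N * int N - int N"
    by (simp add: of_nat_diff power2_eq_square)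
  then show ?thesis by (simp add: M_def right_diff_distrib)
qed

lemma L_mult_L': "L ** L' = mat M"
proof -
  have "L ** L' = mat (int N) ** mat (int N) - A ** A"
    by (simp add: L_def L'_def matrix_add_ldistrib matrix_minus_rdistrib mat_commute[of _ A])
  also have "\<dots> = mat M"
    by (simp add: A_square vec_eq_iff mat_mult_component M_def) (simp add: mat_def algebra_simps)
  finally show ?thesis .
qed

lemma L'_mult_L: "L' ** L = mat M"
proof -
  have "L' ** L = L ** L'"
    by (simp add: L_def L'_def matrix_add_ldistrib matrix_minus_ldistrib matrix_add_rdistrib
        matrix_minus_rdistrib mat_commute[of _ A])
  then show ?thesis by (simp add: L_mult_L')
qed

lemma S_conj_L: "S ** L ** S = L'"
proof -
  have "S ** mat (int N) ** S = mat (int N) ** (S ** S)"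
    by (simp add: mat_commute matrix_mul_assoc)
  then show ?thesis
    by (simp add: L_def L'_def matrix_minus_ldistrib matrix_minus_rdistrib S_square S_conj)
qed

lemma S_conj_L': "S ** L' ** S = L"
proof -
  have "S ** L' ** S = (S ** S) ** L ** (S ** S)"
    by (simp add: S_conj_L[symmetric] matrix_mul_assoc)
  then show ?thesis by (simp add: S_square)
qed

lemma S_invertible: "invertible S"
  unfolding invertible_def by (rule exI[of _ S]) (simp add: S_square)

text \<open>Modulo \<open>N\<close> one has \<open>2 = L' ** B - B ** L\<close>, modulo \<open>N - 1\<close> one has \<open>2 = L' + L\<close>; the
  Chinese remainder theorem suggests the coefficients.\<close>

lemma two_eq_combination:
  obtains X Y where "mat 2 = S ** L ** S ** X + Y ** L"
proof -
  define n where "n = int N"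
  \<comment> \<open>Both \<open>L' + L = mat (2 * n)\<close> and
    \<open>L' ** B - B ** L = mat 2\<close> are exact. Weighted by \<open>n\<close> and
    \<open>- (n - 1)\<close> they add up to \<open>2 + 2 * M\<close>; the term
    \<open>- mat 2 ** L\<close> removes \<open>2 * M\<close>, since
    \<open>L' ** L = mat M\<close>.\<close>
  define X where "X = mat n - mat (n - 1) ** B - mat 2 ** L"
  define Y where "Y = mat n + mat (n - 1) ** B"
  have "L' ** B - B ** L = A ** B + B ** A"
    by (simp add: L_def L'_def matrix_minus_ldistrib matrix_add_rdistrib mat_commute)
  then have 1: "L' ** B = mat 2 + B ** L"
    by (simp add: anticommutator algebra_simps)
  have "L' ** X = mat n ** L' - mat (n - 1) ** (L' ** B) - mat 2 ** (L' ** L)"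
    by (simp add: X_def matrix_minus_ldistrib mat_mult_left_commute) (simp add: mat_commute)
  then have "(L' ** X)$i$j = n * L'$i$j - (n - 1) * (mat 2$i$j + (B ** L)$i$j) - 2 * mat M$i$j" for i j
    unfolding L'_mult_L 1 by (simp add: mat_mult_component)
  moreover have "Y ** L = mat n ** L + mat (n - 1) ** (B ** L)"
    by (simp add: Y_def matrix_add_rdistrib matrix_mul_assoc)
  ultimately have *: "(L' ** X + Y ** L)$i$j = n * (L'$i$j + L$i$j) - (n - 1) * (mat 2$i$j) - 2 * mat M$i$j" for i j
    by (simp add: mat_mult_component algebra_simps)
  have "(L' ** X + Y ** L)$i$j = mat 2$i$j" for i j
    unfolding * by (simp add: L_def L'_def M_def n_def mat_def algebra_simps)
  then have "mat 2 = S ** L ** S ** X + Y ** L"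
    by (simp add: S_conj_L vec_eq_iff)
  then show thesis by (rule that)
qed

text \<open>Conjugation by \<open>S\<close> exchanges \<open>L\<close> and \<open>L'\<close>, which
  carries the relation over to \<open>L'\<close>, as required for the second half of the
  diagonal.\<close>

lemma two_eq_combination':
  obtains X Y where "mat 2 = S ** L' ** S ** X + Y ** L'"
proof -
  have cancel: "Z ** S ** S = Z" for Z :: "int^'n^'n"
    by (simp add: matrix_mul_assoc[symmetric] S_square)
  obtain X Y where XY: "mat 2 = S ** L ** S ** X + Y ** L" by (rule two_eq_combination)
  have "mat 2 = mat 2 ** (S ** S)" by (simp add: S_square)
  also have "\<dots> = S ** mat 2 ** S" by (simp add: mat_commute matrix_mul_assoc)
  also have "\<dots> = L ** (S ** X ** S) + (S ** Y ** S) ** (S ** L ** S)"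
    unfolding XY
    by (simp add: matrix_add_ldistrib matrix_add_rdistrib matrix_mul_assoc S_square cancel)
  also have "\<dots> = S ** L' ** S ** (S ** X ** S) + (S ** Y ** S) ** L'"
    unfolding S_conj_L' S_conj_L ..
  finally show thesis by (rule that)
qed

text \<open>Being conjugate by \<open>S\<close>, \<open>L\<close> and \<open>L'\<close> have the
  same determinant, and their product is \<open>mat M\<close>.\<close>

lemma det_L_square: "(det L)\<^sup>2 = M ^ CARD('n)"
proof -
  have "det S * det S = 1" using S_square by (metis det_I det_mul)
  then have "det L' = det L"
    unfolding S_conj_L[symmetric] by (simp add: det_mul algebra_simps)
  moreover have "det L * det L' = M ^ CARD('n)"
    by (simp add: det_mul[symmetric] L_mult_L' det_mat)
  ultimately show ?thesis by (simp add: power2_eq_square)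
qed

section \<open>Invariant factors of \<open>L\<close> and its torsion cokernel\<close>

text \<open>The witness \<open>k\<close> is the number of diagonal entries of absolute value 2 in
  the first half of the divisibility chain.\<close>

theorem torsion_cokernel_L:
  assumes n: "CARD('n) = 2 * h"
  shows "\<exists>k\<le>h. rank_F2 L = h - k \<and> torsion_subgroup (cokernel L) \<cong>
    cyclic_power 2 k \<times>\<times> cyclic_power ((N^2 - N) div 2) k \<times>\<times> cyclic_power (N^2 - N) (h - k)"
proof -
  obtain P Q D :: "int^'n^'n" and f where PQ: "invertible P" "invertible Q" "D = P ** L ** Q"
    and diag: "\<And>i j. i \<noteq> j \<Longrightarrow> D$i$j = 0"
    and f: "bij_betw f {..<CARD('n)} UNIV"
    and chain: "\<And>i j. i \<le> j \<Longrightarrow> j < CARD('n) \<Longrightarrow> D$f i$f i dvd D$f j$f j"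
    by (rule smith_normal_form[of L]) blast
  have inj: "inj_on f {..<2 * h}" and surj: "f ` {..<2 * h} = UNIV"
    using f by (auto simp: n bij_betw_def)
  obtain P' Q' where inv: "P ** P' = mat 1" "P' ** P = mat 1" "Q ** Q' = mat 1" "Q' ** Q = mat 1"
    using PQ unfolding invertible_def by blast
  have inv': "invertible P'" "invertible Q'" using inv unfolding invertible_def by blast+
  have L: "L = P' ** D ** Q'"
  proof -
    have "P' ** D ** Q' = (P' ** P) ** L ** (Q ** Q')" by (simp add: PQ(3) matrix_mul_assoc)
    then show ?thesis by (simp add: inv)
  qed
  \<comment> \<open>By \<open>L ** L' = mat M\<close> the inverse changes of basis make
    \<open>L'\<close> diagonal too. Corresponding entries of \<open>D\<close> and \<open>D'\<close>
    multiply to \<open>M\<close>, so the divisibility chain of \<open>D'\<close> is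
    reversed.\<close>
  define D' where "D' = Q' ** L' ** P'"
  have L': "L' = Q ** D' ** P"
  proof -
    have "Q ** D' ** P = (Q ** Q') ** L' ** (P' ** P)" by (simp add: D'_def matrix_mul_assoc)
    then show ?thesis by (simp add: inv)
  qed
  have "D ** D' = P ** L ** (Q ** Q') ** L' ** P'"
    by (simp add: D'_def PQ(3) matrix_mul_assoc)
  also have "\<dots> = P ** (L ** L') ** P'" by (simp add: inv matrix_mul_assoc)
  also have "\<dots> = mat M ** (P ** P')" by (simp add: L_mult_L' mat_commute matrix_mul_assoc)
  finally have "D ** D' = mat M" by (simp add: inv)
  then have DD': "D$i$i * D'$i$j = mat M$i$j" for i j
    by (metis diagonal_mult_left[OF diag])
  then have DD'_ii: "D$i$i * D'$i$i = M" for i by (simp add: mat_def)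
  then have nz: "D$i$i \<noteq> 0" "D'$i$i \<noteq> 0" for i
  proof -
    have "D$i$i * D'$i$i \<noteq> 0" unfolding DD'_ii using M_pos by simp
    then show "D$i$i \<noteq> 0" "D'$i$i \<noteq> 0" by simp_all
  qed
  have diag': "D'$i$j = 0" if "i \<noteq> j" for i j
    using DD'[of i j] that nz[of i] by (simp add: mat_def)
  have chain': "D'$f j$f j dvd D'$f i$f i" if "i \<le> j" "j < 2 * h" for i j
  proof -
    have "D$f i$f i dvd D$f j$f j" using chain that n by simp
    then obtain c where c: "D$f j$f j = D$f i$f i * c" by (rule dvdE)
    have "D$f i$f i * D'$f i$f i = D$f i$f i * (c * D'$f j$f j)"
      using DD'_ii[of "f i"] DD'_ii[of "f j"] c by (simp add: mult.assoc)
    then show ?thesis using nz by simp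
  qed
  define d where "d i = \<bar>D$f i$f i\<bar>" for i
  define e where "e i = \<bar>D'$f i$f i\<bar>" for i
  have de: "d i * e i = M" for i
    using DD'_ii[of "f i"] M_pos by (simp add: d_def e_def abs_mult[symmetric])
  have d_low: "d i = 1 \<or> d i = 2" if "i < h" for i
  proof -
    obtain X Y where XY: "mat 2 = S ** L ** S ** X + Y ** L" by (rule two_eq_combination)
    \<comment> \<open>The entry at \<open>i\<close> divides all from \<open>i\<close> on; for
      \<open>i < h\<close> these are at least \<open>h + 1\<close>, more than half.\<close>
    have "card (f ` {i..<2 * h}) = 2 * h - i"
      by (subst card_image[OF inj_on_subset[OF inj]]) auto
    then have card: "CARD('n) < 2 * card (f ` {i..<2 * h})" using that n by simp
    have dvd: "D$f i$f i dvd D$j$j" if "j \<in> f ` {i..<2 * h}" for j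
      using that n by (auto intro: chain)
    have "D$f i$f i dvd 2"
      by (rule diagonal_common_divisor[OF L inv' S_invertible diag XY card]) (erule dvd | simp)+
    then show ?thesis unfolding dvd_2_iff d_def .
  qed
  have e_high: "e i = 1 \<or> e i = 2" if "h \<le> i" "i < 2 * h" for i
  proof -
    obtain X Y where XY: "mat 2 = S ** L' ** S ** X + Y ** L'" by (rule two_eq_combination')
    \<comment> \<open>The reversed chain makes the entry at \<open>i\<close> divide those up to
      \<open>i\<close>; for \<open>i \<ge> h\<close> these are again at least
      \<open>h + 1\<close>.\<close>
    have "card (f ` {..i}) = i + 1"
      using that by (subst card_image[OF inj_on_subset[OF inj]]) auto
    then have card: "CARD('n) < 2 * card (f ` {..i})" using that n by simp
    have dvd: "D'$f i$f i dvd D'$j$j" if "j \<in> f ` {..i}" for j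
      using that \<open>i < 2 * h\<close> by (auto intro: chain')
    have "D'$f i$f i dvd 2"
      by (rule diagonal_common_divisor[OF L' PQ(2,1) S_invertible diag' XY card]) (erule dvd | simp)+
    then show ?thesis unfolding dvd_2_iff e_def .
  qed
  \<comment> \<open>In the second half the class is read off from the complementary entry:
    \<open>d i\<close> is \<open>M div 2\<close> on \<open>J\<close> and \<open>M\<close> on
    \<open>K\<close>.\<close>
  define I where "I = {i. i < h \<and> d i = 2}"
  define J where "J = {i. h \<le> i \<and> i < 2 * h \<and> e i = 2}"
  define K where "K = {i. h \<le> i \<and> i < 2 * h \<and> e i = 1}"
  have fin: "finite I" "finite J" "finite K" by (simp_all add: I_def J_def K_def)
  have card_JK: "card J + card K = h"
  proof -
    have "J \<union> K = {h..<2 * h}" "J \<inter> K = {}" by (auto simp: J_def K_def dest: e_high)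
    then show ?thesis using card_Un_disjoint[OF fin(2,3)] by simp
  qed
  have card_I: "card I \<le> h"
    using card_mono[of "{..<h}" I] by (auto simp: I_def)
  have prod_low: "(\<Prod>i<h. d i) = 2 ^ card I"
  proof -
    have "(\<Prod>i<h. d i) = (\<Prod>i<h. if i \<in> I then 2 else 1)"
      by (intro prod.cong) (auto simp: I_def dest: d_low)
    also have "\<dots> = (\<Prod>i\<in>{..<h} \<inter> I. 2)" by (rule prod.inter_restrict[symmetric]) simp
    also have "{..<h} \<inter> I = I" by (auto simp: I_def)
    finally show ?thesis by simp
  qed
  have prod_high: "(\<Prod>i\<in>{h..<2*h}. e i) = 2 ^ card J"
  proof -
    have "(\<Prod>i\<in>{h..<2*h}. e i) = (\<Prod>i\<in>{h..<2*h}. if i \<in> J then 2 else 1)"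
      by (intro prod.cong) (auto simp: J_def dest: e_high)
    also have "\<dots> = (\<Prod>i\<in>{h..<2*h} \<inter> J. 2)" by (rule prod.inter_restrict[symmetric]) simp
    also have "{h..<2*h} \<inter> J = J" by (auto simp: J_def)
    finally show ?thesis by simp
  qed
  \<comment> \<open>Both \<open>R * 2 ^ card J\<close> and \<open>2 ^ card I * R\<close> will equal
    \<open>M ^ h\<close>, the first by \<open>d i * e i = M\<close>, the second by the determinant.
    Cancelling \<open>R\<close> gives \<open>card I = card J\<close>.\<close>
  define R where "R = (\<Prod>i\<in>{h..<2*h}. d i)"
  have R: "R * 2 ^ card J = M ^ h"
    unfolding R_def prod_high[symmetric] prod.distrib[symmetric] de by simp
  have "\<bar>det D\<bar> = (\<Prod>i<2*h. d i)"
    using prod.reindex[OF inj, of "\<lambda>i. \<bar>D$i$i\<bar>"]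
    by (simp add: det_diagonal[OF diag] abs_prod surj d_def o_def)
  also have "{..<2*h} = {..<h} \<union> {h..<2*h}" by auto
  also have "(\<Prod>i\<in>\<dots>. d i) = 2 ^ card I * R"
    by (subst prod.union_disjoint) (auto simp: prod_low R_def)
  finally have "\<bar>det D\<bar> = 2 ^ card I * R" .
  moreover have "\<bar>det D\<bar> = \<bar>det L\<bar>"
    using unit_det_of_invertible[OF PQ(1)] unit_det_of_invertible[OF PQ(2)]
    by (simp add: PQ(3) det_mul abs_mult)
  moreover have "\<bar>det L\<bar> = M ^ h"
  proof -
    have "\<bar>det L\<bar>\<^sup>2 = (M ^ h)\<^sup>2"
      using det_L_square by (simp add: n power_mult[symmetric] mult.commute)
    then show ?thesis by (rule power2_eq_imp_eq) (use M_pos in auto)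
  qed
  ultimately have "R * 2 ^ card I = R * 2 ^ card J" by (metis R mult.commute)
  moreover have "R \<noteq> 0"
  proof
    assume "R = 0"
    then have "M ^ h = 0" using R by simp
    then show False using M_pos by simp
  qed
  ultimately have card_IJ: "card I = card J" by simp
  have "{i. odd (D$i$i)} = f ` ({..<h} - I)"
  proof -
    have "odd (d i) \<longleftrightarrow> i \<in> {..<h} - I" if i: "i < 2 * h" for i
    proof (cases "i < h")
      case True
      then show ?thesis using d_low[of i] by (auto simp: I_def)
    next
      case False
      have "even (d i)"
      proof (cases "e i = 1")
        case True
        then show ?thesis using de[of i] even_M by simp
      next
        case e: False
        then have "i \<in> J" using e_high[of i] False i by (auto simp: J_def)
        \<comment> \<open>Here \<open>d i\<close> is \<open>M div 2\<close>, whose parity is not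
          known beforehand. As \<open>card I = card J\<close>, a factor 2 occurs in the first half,
          and it divides \<open>d i\<close>.\<close>
        then have "card I \<noteq> 0" using card_IJ fin by auto
        then obtain l where l: "l \<in> I" by fastforce
        then have "l < h" "d l = 2" by (simp_all add: I_def)
        have "d l dvd d i"
          using chain[of l i] \<open>l < h\<close> False i n by (simp add: d_def)
        moreover have "even (d l)" using \<open>d l = 2\<close> by simp
        ultimately show ?thesis by (rule dvd_trans[rotated])
      qed
      then show ?thesis using False by simp
    qed
    then have "odd (D$f i$f i) \<longleftrightarrow> i \<in> {..<h} - I" if "i < 2 * h" for i
      using that by (simp only: d_def dvd_abs_iff)
    then have "{x \<in> f ` {..<2 * h}. odd (D$x$x)} = f ` {i \<in> {..<2 * h}. i \<in> {..<h} - I}"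
      by blast
    also have "{i \<in> {..<2 * h}. i \<in> {..<h} - I} = {..<h} - I" by auto
    finally show ?thesis by (simp add: surj)
  qed
  then have "card {i. odd (D$i$i)} = card (f ` ({..<h} - I))" by simp
  also have "\<dots> = card ({..<h} - I)"
    by (intro card_image inj_on_subset[OF inj]) auto
  also have "\<dots> = h - card I"
    using fin by (subst card_Diff_subset) (auto simp: I_def)
  finally have rank: "rank_F2 L = h - card I"
    using rank_F2_diagonal[OF PQ diag] by simp
  have card_f: "card (f ` I) = card I" "card (f ` J) = card J" "card (f ` K) = card K"
    by (intro card_image inj_on_subset[OF inj]; force simp: I_def J_def K_def)+
  have sub: "I \<subseteq> {..<2*h}" "J \<subseteq> {..<2*h}" "K \<subseteq> {..<2*h}" by (auto simp: I_def J_def K_def)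
  have "I \<inter> J = {}" "I \<inter> K = {}" "J \<inter> K = {}" by (auto simp: I_def J_def K_def)
  then have disj: "f ` I \<inter> f ` J = {}" "f ` I \<inter> f ` K = {}" "f ` J \<inter> f ` K = {}"
    using inj_on_image_Int[OF inj] sub by (metis image_empty)+
  have M2: "int (N^2 - N) = M" "int ((N^2 - N) div 2) = M div 2"
    by (simp_all add: M_eq zdiv_int)
  have pos: "(N^2 - N) div 2 > 0" "N^2 - N > 0"
    using M2 M_pos even_M by (auto elim!: evenE)
  have "torsion_subgroup (cokernel L) \<cong> cyclic_power 2 (card (f ` I)) \<times>\<times>
      cyclic_power ((N^2 - N) div 2) (card (f ` J)) \<times>\<times> cyclic_power (N^2 - N) (card (f ` K))"
  proof (rule torsion_cokernel_iso_cyclic_powers[OF PQ diag disj _ pos])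
    show "\<bar>D$x$x\<bar> = int 2" if "x \<in> f ` I" for x
      using that by (auto simp: I_def d_def)
    show "\<bar>D$x$x\<bar> = int ((N^2 - N) div 2)" if x: "x \<in> f ` J" for x
    proof -
      obtain i where "i \<in> J" "x = f i" using x by blast
      then have "\<bar>D$x$x\<bar> * 2 = M" using de[of i] by (simp add: J_def d_def)
      then show ?thesis unfolding M2 by linarith
    qed
    show "\<bar>D$x$x\<bar> = int (N^2 - N)" if x: "x \<in> f ` K" for x
    proof -
      obtain i where "i \<in> K" "x = f i" using x by blast
      then show ?thesis unfolding M2 using de[of i] by (simp add: K_def d_def)
    qed
    show "\<bar>D$x$x\<bar> = 1" if "x \<notin> f ` I \<union> f ` J \<union> f ` K" for x
    proof -
      obtain i where i: "i < 2 * h" "x = f i" using surj by blast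
      with that have "i \<notin> I" "i \<notin> J" "i \<notin> K" by auto
      then have "i < h" "d i \<noteq> 2" using i(1) e_high[of i] by (cases "h \<le> i"; simp add: I_def J_def K_def)+
      then show ?thesis using d_low[of i] i(2) by (simp add: d_def)
    qed
  qed auto
  moreover have "card K = h - card I" using card_JK card_IJ by simp
  ultimately show ?thesis
    using rank card_I unfolding card_f card_IJ by auto
qed

end

section \<open>Adinkras\<close>

lemma matrix_sum_ldistrib:
  fixes A :: "'a::semiring_1^'n^'m" and B :: "'b \<Rightarrow> 'a^'k^'n"
  shows "A ** (\<Sum>i\<in>I. B i) = (\<Sum>i\<in>I. A ** B i)"
  by (induction I rule: infinite_finite_induct) (simp_all add: matrix_add_ldistrib)

lemma matrix_sum_rdistrib:
  fixes A :: "'b \<Rightarrow> 'a::semiring_1^'n^'m" and B :: "'a^'k^'n"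
  shows "(\<Sum>i\<in>I. A i) ** B = (\<Sum>i\<in>I. A i ** B)"
  by (induction I rule: infinite_finite_induct) (simp_all add: matrix_add_rdistrib)

text \<open>Rotating the cycle brings the given edge to the front, and reflecting it if necessary
  gives the edge the wanted direction.\<close>

lemma four_cycle_starting_at:
  assumes "four_cycle C" "{x, y} \<in> C"
  obtains c d where "distinct [x, y, c, d]" "C = {{x, y}, {y, c}, {c, d}, {d, x}}"
proof -
  note witness = that
  have *: thesis if "distinct [a, b, c, d]" "C = {{a, b}, {b, c}, {c, d}, {d, a}}" "{x, y} = {a, b}"
    for a b c d
  proof (cases "x = a \<and> y = b")
    case True
    then show thesis using witness[of c d] that by simp
  next
    case False
    then have "x = b" "y = a" using that(3) by (auto simp: doubleton_eq_iff)
    moreover from this have "C = {{x, y}, {y, d}, {d, c}, {c, x}}"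
      using that(2) by (auto simp: insert_commute)
    ultimately show thesis using witness[of d c] that(1) by auto
  qed
  obtain a b c d where abcd: "distinct [a, b, c, d]" "C = {{a, b}, {b, c}, {c, d}, {d, a}}"
    using assms(1) unfolding four_cycle_def by blast
  have rot: "C = {{b, c}, {c, d}, {d, a}, {a, b}}" "C = {{c, d}, {d, a}, {a, b}, {b, c}}"
    "C = {{d, a}, {a, b}, {b, c}, {c, d}}"
    using abcd(2) by auto
  consider "{x, y} = {a, b}" | "{x, y} = {b, c}" | "{x, y} = {c, d}" | "{x, y} = {d, a}"
    using assms(2) abcd(2) by blast
  then show thesis
  proof cases
    case 1 then show thesis using * abcd by blast
  next
    case 2 then show thesis using *[OF _ rot(1)] abcd(1) by auto
  next
    case 3 then show thesis using *[OF _ rot(2)] abcd(1) by auto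
  next
    case 4 then show thesis using *[OF _ rot(3)] abcd(1) by auto
  qed
qed

text \<open>Translates an odd number of negative edges into a product of signs equal to
  \<open>-1\<close>.\<close>

lemma prod_signs:
  assumes "finite C" "\<And>e. e \<in> C \<Longrightarrow> \<sigma> e = 1 \<or> \<sigma> e = (-1 :: int)"
  shows "(\<Prod>e\<in>C. \<sigma> e) = (-1) ^ card {e \<in> C. \<sigma> e = -1}"
proof -
  have "(\<Prod>e\<in>C. \<sigma> e) = (\<Prod>e\<in>C. if \<sigma> e = -1 then -1 else 1)"
    using assms(2) by (intro prod.cong) auto
  also have "\<dots> = (\<Prod>e\<in>{e \<in> C. \<sigma> e = -1}. -1)"
    by (rule prod.inter_filter[symmetric]) (rule assms)
  finally show ?thesis by simp
qed

context adinkra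
begin

section \<open>Neighbours along a colour and two-coloured squares\<close>

text \<open>The other end of the edge of colour \<open>i\<close> at \<open>x\<close>; the
  description is known to be proper for \<open>i < N\<close>.\<close>

definition nb :: "nat \<Rightarrow> 'v \<Rightarrow> 'v" where
  "nb i x = (THE y. {x, y} \<in> E \<and> col {x, y} = i)"

lemma nb_unique: "i < N \<Longrightarrow> \<exists>!y. {x, y} \<in> E \<and> col {x, y} = i"
proof -
  assume "i < N"
  then obtain e where e: "e \<in> E" "x \<in> e" "col e = i"
    and uniq: "\<And>e'. e' \<in> E \<Longrightarrow> x \<in> e' \<Longrightarrow> col e' = i \<Longrightarrow> e' = e"
    using unique_edge[of i x] by blast
  from card_edge[OF e(1)] obtain y where y: "e = {x, y}"
    using e(2) by (auto simp: card_2_iff)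
  show ?thesis
  proof
    show "{x, y} \<in> E \<and> col {x, y} = i" using e y by simp
  next
    fix z assume "{x, z} \<in> E \<and> col {x, z} = i"
    then have "{x, z} = {x, y}" using uniq y by blast
    then show "z = y" by (auto simp: doubleton_eq_iff)
  qed
qed

lemma nb_edge: "i < N \<Longrightarrow> {x, nb i x} \<in> E" "i < N \<Longrightarrow> col {x, nb i x} = i"
  unfolding nb_def using theI'[OF nb_unique] by blast+

lemma nb_eqI: "{x, y} \<in> E \<Longrightarrow> nb (col {x, y}) x = y"
proof -
  assume e: "{x, y} \<in> E"
  then have "col {x, y} < N" using col_edge by auto
  then show ?thesis using nb_unique nb_edge e by blast
qed

lemma nb_nb: "i < N \<Longrightarrow> nb i (nb i x) = x"
  using nb_eqI[of "nb i x" x] nb_edge[of i x] by (simp add: insert_commute)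

lemma sign_cases: "e \<in> E \<Longrightarrow> \<sigma> e = 1 \<or> \<sigma> e = -1"
  using sign_edge by auto

text \<open>The four-cycle of colours \<open>i\<close> and \<open>j\<close> through the edge from
  \<open>x\<close> to \<open>nb i x\<close> closes up at \<open>w\<close>, and odd dashing fixes the
  product of its signs.\<close>

lemma bicolored_square:
  fixes x
  assumes ij: "i < N" "j < N" "i \<noteq> j"
  defines "w \<equiv> nb j (nb i x)"
  shows "w = nb i (nb j x)"
    and "\<sigma> {x, nb i x} * \<sigma> {nb i x, w} * (\<sigma> {x, nb j x} * \<sigma> {nb j x, w}) = -1"
proof -
  let ?F = "bicolored_edges E col i j" and ?y = "nb i x"
  obtain \<C> where \<C>: "\<And>C. C \<in> \<C> \<Longrightarrow> four_cycle C" "?F = \<Union>\<C>"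
    using bicolored_cycles[OF ij] unfolding disjoint_union_of_four_cycles_def by blast
  have "{x, ?y} \<in> ?F" using nb_edge ij by (simp add: bicolored_edges_def)
  then obtain C where C: "C \<in> \<C>" "{x, ?y} \<in> C" using \<C> by blast
  then have CF: "C \<subseteq> ?F" and "four_cycle C" using \<C> by blast+
  from four_cycle_starting_at[OF this(2) C(2)] obtain c d where
    dist: "distinct [x, ?y, c, d]" and C_eq: "C = {{x, ?y}, {?y, c}, {c, d}, {d, x}}" by blast
  have F: "nb i a = b \<or> nb j a = b" if "{a, b} \<in> C" for a b
    using CF that nb_eqI[of a b] by (auto simp: bicolored_edges_def)
  \<comment> \<open>Consecutive edges of the cycle are distinct, so their colours alternate; this
    identifies the remaining vertices.\<close>
  have "nb j x = d" using F[of x d] dist by (auto simp: C_eq insert_commute)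
  moreover have "nb j ?y = c" using F[of ?y c] dist nb_nb ij by (auto simp: C_eq)
  moreover have "nb i d = c" using F[of d c] dist nb_nb[of j] ij \<open>nb j x = d\<close>
    by (auto simp: C_eq insert_commute)
  ultimately have w: "w = c" "nb j x = d" "nb i d = c" by (simp_all add: w_def)
  then show "w = nb i (nb j x)" by simp
  have "odd (card {e \<in> C. \<sigma> e = -1})"
    using odd_dashing[OF ij CF \<open>four_cycle C\<close>] .
  moreover have "\<sigma> e = 1 \<or> \<sigma> e = -1" if "e \<in> C" for e
    using CF that by (intro sign_cases) (auto simp: bicolored_edges_def)
  ultimately have "(\<Prod>e\<in>C. \<sigma> e) = -1"
    by (subst prod_signs) (auto simp: C_eq)
  moreover have "(\<Prod>e\<in>C. \<sigma> e) = \<sigma> {x, ?y} * (\<sigma> {?y, c} * (\<sigma> {c, d} * \<sigma> {d, x}))"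
    using dist unfolding C_eq by (subst prod.insert; auto simp: doubleton_eq_iff)+
  ultimately show "\<sigma> {x, ?y} * \<sigma> {?y, w} * (\<sigma> {x, nb j x} * \<sigma> {nb j x, w}) = -1"
    by (simp add: w insert_commute mult_ac)
qed

section \<open>Colour matrices and their anticommutation relations\<close>

text \<open>For \<open>i < N\<close> this is the signed permutation matrix of the perfect matching
  formed by the edges of colour \<open>i\<close>.\<close>

definition color_matrix :: "nat \<Rightarrow> int^'v^'v" where
  "color_matrix i = (\<chi> x y. if y = nb i x then \<sigma> {x, y} else 0)"

lemma signed_adjacency_eq_sum: "signed_adjacency E \<sigma> = (\<Sum>i<N. color_matrix i)"
proof -
  have "(if {x, y} \<in> E then \<sigma> {x, y} else 0) = (\<Sum>i<N. if y = nb i x then \<sigma> {x, y} else 0)" for x y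
  proof (cases "{x, y} \<in> E")
    case True
    then have "col {x, y} < N" using col_edge by auto
    have "y = nb i x \<longleftrightarrow> i = col {x, y}" if "i < N" for i
      using nb_eqI[OF True] nb_edge[OF that] by auto
    then have "(\<Sum>i<N. if y = nb i x then \<sigma> {x, y} else 0) = (\<Sum>i<N. if i = col {x, y} then \<sigma> {x, y} else 0)"
      by (intro sum.cong) auto
    then show ?thesis using True \<open>col {x, y} < N\<close> by simp
  next
    case False
    then have "y \<noteq> nb i x" if "i < N" for i using nb_edge[OF that] by auto
    then show ?thesis using False by (auto intro!: sum.neutral[symmetric])
  qed
  then show ?thesis
    by (simp add: signed_adjacency_def color_matrix_def vec_eq_iff)
qed

lemma color_matrix_mult:
  "(color_matrix i ** color_matrix j)$x$y
    = (if y = nb j (nb i x) then \<sigma> {x, nb i x} * \<sigma> {nb i x, y} else 0)"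
proof -
  have "(color_matrix i ** color_matrix j)$x$y
      = (\<Sum>z\<in>UNIV. if z = nb i x then \<sigma> {x, z} * (if y = nb j z then \<sigma> {z, y} else 0) else 0)"
    unfolding matrix_matrix_mult_def color_matrix_def vec_lambda_beta
    by (intro sum.cong) auto
  then show ?thesis by simp
qed

lemma color_matrix_square: "i < N \<Longrightarrow> color_matrix i ** color_matrix i = mat 1"
proof -
  assume i: "i < N"
  have "\<sigma> {x, nb i x} * \<sigma> {nb i x, x} = 1" for x
    using sign_cases[OF nb_edge(1)[OF i, of x]] by (auto simp: insert_commute)
  then show ?thesis
    by (auto simp: vec_eq_iff color_matrix_mult mat_def nb_nb[OF i])
qed

text \<open>The two products have the same support because \<open>nb i\<close> and
  \<open>nb j\<close> commute, and odd dashing gives the two paths to the opposite corner of a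
  square opposite signs.\<close>

lemma color_matrix_anticommute:
  assumes ij: "i < N" "j < N" "i \<noteq> j"
  shows "color_matrix i ** color_matrix j + color_matrix j ** color_matrix i = 0"
proof -
  have "\<sigma> {x, nb i x} * \<sigma> {nb i x, w} + \<sigma> {x, nb j x} * \<sigma> {nb j x, w} = 0"
    if w: "w = nb j (nb i x)" for x w
  proof -
    have "{x, nb i x} \<in> E" "{nb i x, w} \<in> E" "{x, nb j x} \<in> E" "{nb j x, w} \<in> E"
      using nb_edge(1)[OF ij(1)] nb_edge(1)[OF ij(2)] w bicolored_square(1)[OF ij, of x] by metis+
    then show ?thesis
      using bicolored_square(2)[OF ij, of x] unfolding w[symmetric]
      by (auto dest!: sign_cases)
  qed
  then show ?thesis
    by (simp add: vec_eq_iff color_matrix_mult bicolored_square(1)[OF ij, symmetric])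
qed

lemma color_matrix_anticommutator:
  assumes "i < N" "j < N"
  shows "color_matrix i ** color_matrix j + color_matrix j ** color_matrix i
    = (if i = j then mat 2 else 0)"
proof (cases "i = j")
  case True
  have "mat 1 + mat 1 = (mat 2 :: int^'v^'v)" by (simp add: mat_def vec_eq_iff)
  then show ?thesis using True assms by (simp add: color_matrix_square)
qed (use assms color_matrix_anticommute in simp)

lemma adjacency_anticommutator:
  assumes "j < N"
  shows "signed_adjacency E \<sigma> ** color_matrix j + color_matrix j ** signed_adjacency E \<sigma> = mat 2"
proof -
  have "signed_adjacency E \<sigma> ** color_matrix j + color_matrix j ** signed_adjacency E \<sigma>
      = (\<Sum>i<N. color_matrix i ** color_matrix j + color_matrix j ** color_matrix i)"
    by (simp add: signed_adjacency_eq_sum matrix_sum_ldistrib matrix_sum_rdistrib sum.distrib)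
  also have "\<dots> = (\<Sum>i<N. if i = j then mat 2 else 0)"
    using assms by (intro sum.cong) (auto simp: color_matrix_anticommutator)
  finally show ?thesis using assms by simp
qed

text \<open>Summing the anticommutators with all \<open>N\<close> colour matrices doubles the square
  on one side and gives \<open>2 * N\<close> on the other.\<close>

lemma adjacency_square: "signed_adjacency E \<sigma> ** signed_adjacency E \<sigma> = mat (int N)"
proof -
  let ?A = "signed_adjacency E \<sigma>"
  have "?A ** ?A + ?A ** ?A = (\<Sum>j<N. ?A ** color_matrix j) + (\<Sum>j<N. color_matrix j ** ?A)"
    by (metis signed_adjacency_eq_sum matrix_sum_ldistrib matrix_sum_rdistrib)
  also have "\<dots> = (\<Sum>j<N. mat 2)"
    unfolding sum.distrib[symmetric] by (intro sum.cong) (auto simp: adjacency_anticommutator)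
  finally have "(?A ** ?A)$x$y + (?A ** ?A)$x$y = (\<Sum>j<N. mat 2)$x$y" for x y
    by (metis vector_add_component)
  moreover have "(\<Sum>j<N. mat 2)$x$y = 2 * (mat (int N) :: int^'v^'v)$x$y" for x y
    unfolding sum_component by (simp add: mat_def)
  ultimately have "(?A ** ?A)$x$y = mat (int N)$x$y" for x y
    by (metis mult_2 mult_left_cancel zero_neq_numeral)
  then show ?thesis by (simp add: vec_eq_iff)
qed

section \<open>Regularity, bipartition and signs modulo 2\<close>

lemma degree_matrix_eq: "degree_matrix E = mat (int N)"
proof -
  have "card {e \<in> E. x \<in> e} = N" for x
  proof -
    have "bij_betw (\<lambda>i. {x, nb i x}) {..<N} {e \<in> E. x \<in> e}"
    proof (rule bij_betw_byWitness[where f' = col])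
      show "\<forall>e\<in>{e \<in> E. x \<in> e}. {x, nb (col e) x} = e"
      proof
        fix e assume e: "e \<in> {e \<in> E. x \<in> e}"
        then obtain y where "e = {x, y}" using card_edge[of e] by (auto simp: card_2_iff)
        then show "{x, nb (col e) x} = e" using e nb_eqI by simp
      qed
    qed (use col_edge nb_edge in auto)
    from bij_betw_same_card[OF this] show ?thesis by simp
  qed
  then show ?thesis by (simp add: degree_matrix_def mat_def vec_eq_iff)
qed

lemma bipartition:
  assumes "N > 0"
  obtains S :: "int^'v^'v" and h where "S ** S = mat 1"
    "S ** signed_adjacency E \<sigma> ** S = - signed_adjacency E \<sigma>" "CARD('v) = 2 * h"
proof -
  obtain T where T: "\<And>e. e \<in> E \<Longrightarrow> \<exists>x\<in>T. \<exists>y\<in>-T. e = {x, y}"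
    using is_bipartite unfolding bipartite_def by blast
  have T': "x \<in> T \<longleftrightarrow> y \<notin> T" if "{x, y} \<in> E" for x y
    using T[OF that] by (auto simp: doubleton_eq_iff)
  define S :: "int^'v^'v" where "S = (\<chi> x y. if x = y then (if x \<in> T then 1 else -1) else 0)"
  have S: "S$x$y = 0" if "x \<noteq> y" for x y using that by (simp add: S_def)
  have "S ** S = mat 1"
    by (simp add: vec_eq_iff diagonal_mult_left[OF S]) (simp add: S_def mat_def)
  moreover have "S ** signed_adjacency E \<sigma> ** S = - signed_adjacency E \<sigma>"
    using T' by (auto simp: vec_eq_iff diagonal_mult_left[OF S] diagonal_mult_right[OF S])
      (auto simp: S_def signed_adjacency_def)
  moreover have "CARD('v) = 2 * card T"
  proof -
    \<comment> \<open>The edges of colour 0 match the two sides of the bipartition perfectly, so the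
      number of vertices is even.\<close>
    have "nb 0 x \<in> T \<longleftrightarrow> x \<notin> T" for x
      using T'[OF nb_edge(1)[OF assms, of x]] by blast
    then have "bij_betw (nb 0) T (- T)"
      by (intro bij_betw_byWitness[where f' = "nb 0"]) (auto simp: nb_nb[OF assms])
    then have "card (- T) = card T" by (metis bij_betw_same_card)
    moreover have "CARD('v) = card T + card (- T)"
      using card_Un_disjoint[of T "- T"] by simp
    ultimately show ?thesis by simp
  qed
  ultimately show thesis by (rule that)
qed

text \<open>The signs \<open>1\<close> and \<open>-1\<close> agree modulo 2, so the unsigned rank
  can be read off the signed Laplacian.\<close>

lemma rank_F2_laplacian: "rank_F2 (laplacian E) = rank_F2 (signed_laplacian E \<sigma>)"
proof -
  have sign: "(of_int (\<sigma> e) :: bit) = 1" if "e \<in> E" for e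
    using sign_cases[OF that] by auto
  have "(map_matrix of_int (laplacian E) :: bit^'v^'v) = map_matrix of_int (signed_laplacian E \<sigma>)"
    using sign by (simp add: laplacian_def signed_laplacian_def signed_adjacency_def vec_eq_iff)
  then show ?thesis unfolding rank_F2_def by simp
qed

end

text \<open>The equation defining \<open>m\<close> is read over the rationals, so that no truncated
  division or subtraction hides in it. Unique existence and \<open>0 \<le> m\<close> make
  \<open>nat m\<close> the intended exponent.\<close>

theorem theorem1p2:
  fixes E :: "'v::finite set set" and \<sigma> :: "'v set \<Rightarrow> int"
    and N v :: nat and col :: "'v set \<Rightarrow> nat"
  assumes "N \<ge> 2"
    and "adinkra E \<sigma> N col"
    and "v = CARD('v)"
  shows "(\<exists>!m::int. rat_of_nat (rank_F2 (laplacian E)) = rat_of_nat v / 2 - rat_of_int m) \<and>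
    (\<forall>m::int. rat_of_nat (rank_F2 (laplacian E)) = rat_of_nat v / 2 - rat_of_int m \<longrightarrow>
       0 \<le> m \<and>
       critical_group E \<sigma> \<cong>
         cyclic_power 2 (nat m) \<times>\<times>
         cyclic_power ((N^2 - N) div 2) (nat m) \<times>\<times>
         cyclic_power (N^2 - N) (v div 2 - nat m))"
proof -
  interpret adinkra E \<sigma> N col by fact
  obtain S :: "int^'v^'v" and h where S: "S ** S = mat 1"
    "S ** signed_adjacency E \<sigma> ** S = - signed_adjacency E \<sigma>" and h: "CARD('v) = 2 * h"
    using bipartition assms(1) by (metis less_le_trans zero_less_numeral)
  \<comment> \<open>Any colour could play the part of \<open>B\<close>; colour 0 exists because
    \<open>N \<ge> 2\<close>.\<close>
  interpret anticommuting_matrices "signed_adjacency E \<sigma>" "color_matrix 0" S N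
    using assms(1) S by unfold_locales (auto simp: adjacency_square intro!: adjacency_anticommutator)
  have L: "signed_laplacian E \<sigma> = L"
    by (simp add: L_def signed_laplacian_def degree_matrix_eq)
  obtain k where k: "k \<le> h" "rank_F2 L = h - k" "torsion_subgroup (cokernel L) \<cong>
      cyclic_power 2 k \<times>\<times> cyclic_power ((N^2 - N) div 2) k \<times>\<times> cyclic_power (N^2 - N) (h - k)"
    using torsion_cokernel_L[OF h] by blast
  have iff: "rat_of_nat (rank_F2 (laplacian E)) = rat_of_nat v / 2 - rat_of_int m \<longleftrightarrow> m = int k" for m
  proof -
    have "rat_of_nat (rank_F2 (laplacian E)) = rat_of_nat v / 2 - rat_of_int (int k)"
      using k(1) by (simp add: rank_F2_laplacian L k(2) assms(3) h of_nat_diff)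
    then show ?thesis by auto
  qed
  have "v div 2 = h" by (simp add: assms(3) h)
  then show ?thesis
    unfolding iff critical_group_def L using k(3) by simp
qed

end
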